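(* Let $n\ge3$. An infinite cutting sequence of a linear trajectory in a regular $2n$-gon is infinitely derivable.
   Context: **Polygon and cutting sequences.** Let $O_{2n}\subset\mathbb{R}^2$ be a regular $2n$-gon centred at the origin with two horizontal sides, opposite sides identified by translation. The pairs of opposite sides are labelled in clockwise order $L_1,\dots,L_n$, with $L_1$ the horizontal pair. A (bi-infinite) linear trajectory moves with constant velocity; when it hits a side it re-enters $O_{2n}$ at the corresponding point of the opposite side with the same velocity; it never hits a vertex and is defined for all times. Its (infinite) cutting sequence is the bi-infinite word in $\{L_1,\dots,L_n\}$ of labels of sides crossed (considered up to shift). **Admissibility.** For $0\le i\le 2n-1$ let $\nu_i$ be the linear isometry of $O_{2n}$ acting on directions by $\theta\mapsto\theta-i\pi/2n$ (rotation) if $i$ is even and by $\theta\mapsto(i+1)\pi/2n-\theta$ (reflection) if $i$ is odd. Let $\pi_i$ be the permutation of labels induced by $\nu_i$ ($\pi_i(L)=L'$ iff $\nu_i$ maps sides labelled $L$ to sides labelled $L'$), acting on words letter by letter. A word is admissible in diagram $0$ if each pair $L_iL_j$ of consecutive letters satisfies $i+j\in\{n+1,n+2\}$; it is admissible in diagram $i$ if $\pi_i\cdot w$ is admissible in diagram $0$; it is admissible if it is admissible in diagram $i$ for some $i\in\{0,\dots,2n-1\}$. **Derivation.** A letter occurrence in a bi-infinite word is sandwiched if the letters immediately before and after it are equal; the derived sequence $w'$ keeps only the sandwiched letters of $w$. A word is derivable if it and its derived sequence are admissible; it is infinitely derivable if it is derivable and for each $m$ the result of deriving it $m$ times is again derivable.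 *)

theory Defs
  imports "HOL-Analysis.Analysis"
begin

text \<open>The plane is identified with the complex numbers. The polygon has circumradius \<open>r\<close>; its
  vertices and sides are listed clockwise and indexed by natural numbers modulo \<open>2 * n\<close>. The outward
  normal of side \<open>j\<close> has angle \<open>pi / 2 - j * pi / n\<close>, so side \<open>0\<close> is the top horizontal side.\<close>

definition vertex :: "nat \<Rightarrow> real \<Rightarrow> nat \<Rightarrow> complex" where
  "vertex n r j = rcis r (pi / 2 + pi / (2 * real n) - real j * pi / real n)"

definition polygon :: "nat \<Rightarrow> real \<Rightarrow> complex set" where
  "polygon n r = convex hull (vertex n r ` {..<2 * n})"

definition side :: "nat \<Rightarrow> real \<Rightarrow> nat \<Rightarrow> complex set" where
  "side n r j = closed_segment (vertex n r j) (vertex n r (j + 1))"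

text \<open>The vector of the translation that carries side \<open>j\<close> to the opposite side \<open>j + n\<close>. It takes
  the two end points \<open>j\<close>, \<open>j + 1\<close> to the vertices \<open>j + n + 1\<close>, \<open>j + n\<close>, in this order.\<close>

definition glue :: "nat \<Rightarrow> real \<Rightarrow> nat \<Rightarrow> complex" where
  "glue n r j = vertex n r (j + n + 1) - vertex n r j"

text \<open>The letter \<open>L\<^sub>k\<close> is represented by the number \<open>k \<in> {1..n}\<close>.\<close>

definition label :: "nat \<Rightarrow> nat \<Rightarrow> nat" where
  "label n j = j mod n + 1"

text \<open>Bi-infinite linear trajectories with velocity \<open>v\<close>. At a hitting time \<open>t\<close> the value \<open>\<gamma> t\<close> is, by
  convention, the point at which the trajectory leaves the polygon, so that \<open>\<gamma>\<close> is affine to the left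
  of every time, while to the right of a hitting time it starts from the identified point of the
  opposite side.\<close>

definition linear_trajectory :: "nat \<Rightarrow> real \<Rightarrow> complex \<Rightarrow> (real \<Rightarrow> complex) \<Rightarrow> bool" where
  "linear_trajectory n r v \<gamma> \<longleftrightarrow>
     v \<noteq> 0 \<and>
     (\<forall>t. \<gamma> t \<in> polygon n r - vertex n r ` {..<2 * n}) \<and>
     (\<forall>t. \<forall>\<^sub>F s in at_left t. \<gamma> s = \<gamma> t + (s - t) *\<^sub>R v) \<and>
     (\<forall>t. (\<forall>j<2 * n. \<gamma> t \<notin> side n r j) \<longrightarrow>
        (\<forall>\<^sub>F s in at_right t. \<gamma> s = \<gamma> t + (s - t) *\<^sub>R v)) \<and>
     (\<forall>t. \<forall>j<2 * n. \<gamma> t \<in> side n r j \<longrightarrow>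
        (\<forall>\<^sub>F s in at_right t. \<gamma> s = \<gamma> t + glue n r j + (s - t) *\<^sub>R v))"

text \<open>The function \<open>t\<close> lists all hitting times in increasing order; the freedom in choosing which of
  them is \<open>t 0\<close> accounts for cutting sequences being considered up to shift.\<close>

definition cutting_sequence :: "nat \<Rightarrow> real \<Rightarrow> (real \<Rightarrow> complex) \<Rightarrow> (int \<Rightarrow> nat) \<Rightarrow> bool" where
  "cutting_sequence n r \<gamma> w \<longleftrightarrow>
     (\<exists>t :: int \<Rightarrow> real. strict_mono t \<and>
        range t = {s. \<exists>j<2 * n. \<gamma> s \<in> side n r j} \<and>
        (\<forall>k. \<exists>j<2 * n. \<gamma> (t k) \<in> side n r j \<and> w k = label n j))"

definition nu :: "nat \<Rightarrow> nat \<Rightarrow> complex \<Rightarrow> complex" where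
  "nu n i z = (if even i then cis (- (real i * pi / (2 * real n))) * z
               else cis ((real i + 1) * pi / (2 * real n)) * cnj z)"

definition sides_labelled :: "nat \<Rightarrow> real \<Rightarrow> nat \<Rightarrow> complex set set" where
  "sides_labelled n r L = {side n r j | j. j < 2 * n \<and> label n j = L}"

text \<open>Since the maps \<open>nu n i\<close> are linear, the permutation of labels does not depend on the size of
  the polygon, and the polygon with circumradius \<open>1\<close> is used.\<close>

definition label_perm :: "nat \<Rightarrow> nat \<Rightarrow> nat \<Rightarrow> nat" where
  "label_perm n i L =
     (THE L'. L' \<in> {1..n} \<and> image (nu n i) ` sides_labelled n 1 L = sides_labelled n 1 L')"

definition admissible0 :: "nat \<Rightarrow> (int \<Rightarrow> nat) \<Rightarrow> bool" where
  "admissible0 n w \<longleftrightarrow> range w \<subseteq> {1..n} \<and> (\<forall>k. w k + w (k + 1) \<in> {n + 1, n + 2})"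

definition admissible_in :: "nat \<Rightarrow> nat \<Rightarrow> (int \<Rightarrow> nat) \<Rightarrow> bool" where
  "admissible_in n i w \<longleftrightarrow> range w \<subseteq> {1..n} \<and> admissible0 n (label_perm n i \<circ> w)"

definition admissible :: "nat \<Rightarrow> (int \<Rightarrow> nat) \<Rightarrow> bool" where
  "admissible n w \<longleftrightarrow> (\<exists>i<2 * n. admissible_in n i w)"

definition sandwiched :: "(int \<Rightarrow> nat) \<Rightarrow> int \<Rightarrow> bool" where
  "sandwiched w k \<longleftrightarrow> w (k - 1) = w (k + 1)"

text \<open>The word \<open>w'\<close> is the derived sequence of \<open>w\<close>. A bi-infinite \<open>w'\<close> exists iff there are sandwiched
  letters arbitrarily far in both directions, and it is then unique up to shift.\<close>

definition derived :: "(int \<Rightarrow> nat) \<Rightarrow> (int \<Rightarrow> nat) \<Rightarrow> bool" where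
  "derived w w' \<longleftrightarrow>
     (\<exists>f :: int \<Rightarrow> int. strict_mono f \<and> range f = {k. sandwiched w k} \<and> w' = w \<circ> f)"

definition derivable :: "nat \<Rightarrow> (int \<Rightarrow> nat) \<Rightarrow> bool" where
  "derivable n w \<longleftrightarrow> admissible n w \<and> (\<exists>w'. derived w w' \<and> admissible n w')"

definition infinitely_derivable :: "nat \<Rightarrow> (int \<Rightarrow> nat) \<Rightarrow> bool" where
  "infinitely_derivable n w \<longleftrightarrow>
     derivable n w \<and> (\<forall>m. \<exists>w'. (derived ^^ m) w w' \<and> derivable n w')"

end

theory Submission
  imports Defs
begin

text \<open>
  A line in direction \<open>v\<close> is determined by its height above the line \<open>\<real> v\<close>. Between two hits the
  height of a trajectory is constant, and a hit changes it by the height of a translation, so the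
  trajectory reduces to a sequence of heights. Measured from the midpoint of the side that is hit,
  the heights \<open>x k\<close> satisfy \<open>x k - x (k + 1) = M (w k) + M (w (k + 1))\<close>, where \<open>M L\<close> is the height of
  the midpoint of the exit side labelled \<open>L\<close>, and \<open>\<bar>x k\<bar>\<close> is less than half the extent of that side
  (\<open>cutting_sequence_coded\<close>). The words for which such heights exist, for some direction, form a
  class that is shown to consist of admissible words and to be closed under derivation; infinite
  derivability is then an induction (\<open>coded_infinitely_derivable\<close>).

  By the symmetries of the polygon the direction may be taken at an angle in \<open>[0, pi / (2 * n)]\<close>
  (\<open>coded_label_perm\<close>, \<open>sector_representative\<close>). There the ends of the sides allow only transitions
  whose labels add to \<open>n + 1\<close> or \<open>n + 2\<close>, which is admissibility in diagram \<open>0\<close>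
  (\<open>sector_transition\<close>). A letter is sandwiched when the two transitions at it have the same sum, so
  between sandwiched letters the sums alternate; this makes the sandwiched letters occur with
  bounded gaps (\<open>sandwiched_bounded_gap\<close>).

  Derivation corresponds to the involution \<open>veech\<close> of directions, the derivative of an affine
  automorphism of the glued polygon: the sandwiched letters are the crossings of the transformed
  sides. On codes this is visible without the surface. Two trigonometric identities for each kind
  of transition (\<open>veech_step_up\<close>, \<open>veech_step_down\<close>) show that a sandwiched letter is
  hit within the extent of the transformed side, and that each displacement is, up to a sign
  depending on the kind of the transition, a sum of two transformed midpoint heights. As the kinds alternate between sandwiched letters, these sums telescope
  (\<open>sector_derived_coded\<close>), and the derived word is again coded, with direction \<open>veech n v\<close> and
  heights \<open>- x\<close>.
\<close>

section \<open>Codes of straight lines\<close>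

text \<open>The rotation that carries side \<open>L - 1\<close>, one of the two sides labelled \<open>L\<close>, to the top
  side, applied to \<open>v\<close>. The imaginary part of the result tells whether a line in direction \<open>v\<close>
  leaves the polygon through that side (positive) or enters through it (negative).\<close>

definition ray :: "nat \<Rightarrow> complex \<Rightarrow> nat \<Rightarrow> complex" where
  "ray n v L = v * cis ((real L - 1) * pi / real n)"

text \<open>The height of a point \<open>p\<close> above the line \<open>\<real> v\<close> is measured by \<open>Im (cnj v * p)\<close>. For a polygon of
  apothem \<open>1\<close> the following is the height of the midpoint of the side labelled \<open>L\<close> through which
  lines in direction \<open>v\<close> leave; half a side then has length \<open>tan (pi / (2 * n))\<close>. The opposite side has both
  \<open>Re\<close> and \<open>Im\<close> negated, so the factor \<open>sgn\<close> selects the exit side.\<close>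

definition midheight :: "nat \<Rightarrow> complex \<Rightarrow> nat \<Rightarrow> real" where
  "midheight n v L = sgn (Im (ray n v L)) * Re (ray n v L)"

definition halfwidth :: "nat \<Rightarrow> complex \<Rightarrow> nat \<Rightarrow> real" where
  "halfwidth n v L = tan (pi / (2 * real n)) * \<bar>Im (ray n v L)\<bar>"

text \<open>The words produced by straight lines. Here \<open>x k\<close> is the height, above the line \<open>\<real> v\<close> and
  relative to the midpoint of the side, at which the side \<open>w k\<close> is left; it is smaller than half the
  extent of that side across \<open>v\<close>. The re-entry translates by minus twice the midpoint of the side,
  and otherwise the height is constant, which gives the recursion. A side parallel to \<open>v\<close> has half
  width \<open>0\<close>, so its label does not occur.\<close>

definition coded :: "nat \<Rightarrow> complex \<Rightarrow> (int \<Rightarrow> nat) \<Rightarrow> bool" where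
  "coded n v w \<longleftrightarrow> range w \<subseteq> {1..n} \<and>
     (\<exists>x :: int \<Rightarrow> real. \<forall>k. \<bar>x k\<bar> < halfwidth n v (w k) \<and>
        x k - x (k + 1) = midheight n v (w k) + midheight n v (w (k + 1)))"

lemma label_in: "n > 0 \<Longrightarrow> label n j \<in> {1..n}"
  by (simp add: label_def Suc_leI)

lemma label_minus_1: "L \<in> {1..n} \<Longrightarrow> label n (L - 1) = L"
  by (auto simp: label_def)

lemma cis_nat_pi: "cis (real m * pi) = (-1) ^ m"
  using Complex.DeMoivre[of pi m] by simp

lemma ray_label:
  assumes "n > 0"
  shows "ray n v (label n j) = (-1) ^ (j div n) * (v * cis (real j * pi / real n))"
proof -
  have "real j = real (j mod n) + real (j div n) * real n"
    by (metis mod_div_mult_eq of_nat_add of_nat_mult)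
  then have "real j * pi / real n = real (j mod n) * pi / real n + real (j div n) * pi"
    using assms by (simp add: field_simps)
  then have "cis (real j * pi / real n) = cis (real (j mod n) * pi / real n) * (-1) ^ (j div n)"
    by (simp add: cis_nat_pi flip: cis_mult)
  then show ?thesis by (simp add: ray_def label_def flip: power_add mult_2 power_mult_distrib)
qed

lemma midheight_label:
  assumes "n > 0" "z = v * cis (real j * pi / real n)"
  shows "midheight n v (label n j) = sgn (Im z) * Re z"
  using ray_label[OF assms(1), of v j, folded assms(2)]
  by (cases "even (j div n)") (auto simp: midheight_def sgn_minus)

lemma halfwidth_label:
  assumes "n > 0" "z = v * cis (real j * pi / real n)"
  shows "halfwidth n v (label n j) = tan (pi / (2 * real n)) * \<bar>Im z\<bar>"
  using ray_label[OF assms(1), of v j, folded assms(2)]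
  by (cases "even (j div n)") (auto simp: halfwidth_def)

text \<open>The sign \<open>\<rho>\<close> covers reflections, which reverse heights.\<close>

lemma coded_transport:
  assumes "coded n v w" and "range p' \<subseteq> {1..n}"
    and "\<And>k. p' k = p (w k)"
    and "\<bar>\<rho>\<bar> = (1::real)"
    and "\<And>L. L \<in> {1..n} \<Longrightarrow> midheight n v' (p L) = \<rho> * midheight n v L"
    and "\<And>L. L \<in> {1..n} \<Longrightarrow> halfwidth n v' (p L) = halfwidth n v L"
  shows "coded n v' p'"
proof -
  from assms(1) have w: "w k \<in> {1..n}" for k unfolding coded_def by blast
  from assms(1) obtain x :: "int \<Rightarrow> real" where
    x: "\<forall>k. \<bar>x k\<bar> < halfwidth n v (w k) \<and>
       x k - x (k + 1) = midheight n v (w k) + midheight n v (w (k + 1))"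
    unfolding coded_def by (elim conjE exE)
  have "\<bar>\<rho> * x k\<bar> < halfwidth n v' (p' k) \<and>
      \<rho> * x k - \<rho> * x (k + 1) = midheight n v' (p' k) + midheight n v' (p' (k + 1))" for k
  proof
    show "\<bar>\<rho> * x k\<bar> < halfwidth n v' (p' k)"
      using x w by (simp add: assms(3,4,6) abs_mult)
    have "\<rho> * x k - \<rho> * x (k + 1) = \<rho> * (x k - x (k + 1))" by (simp add: right_diff_distrib)
    also have "\<dots> = \<rho> * (midheight n v (w k) + midheight n v (w (k + 1)))" using x by metis
    finally show "\<rho> * x k - \<rho> * x (k + 1) = midheight n v' (p' k) + midheight n v' (p' (k + 1))"
      using w by (simp add: assms(3,5) distrib_left)
  qed
  then show ?thesis using assms(2) unfolding coded_def by (intro conjI exI[of _ "\<lambda>k. \<rho> * x k"]) blast+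
qed

text \<open>Reversing the direction exchanges exit and entrance sides, which have the same label; this
  is the symmetry of the polygon about its centre.\<close>

lemma coded_uminus:
  assumes "coded n v w"
  shows "coded n (- v) w"
proof -
  have "ray n (- v) L = - ray n v L" for L by (simp add: ray_def)
  then have "midheight n (- v) L = midheight n v L" "halfwidth n (- v) L = halfwidth n v L" for L
    by (simp_all add: midheight_def halfwidth_def sgn_minus)
  then show ?thesis using assms by (simp add: coded_def)
qed

lemma rcis_minus_pi: "rcis r (a - pi) = - rcis r a"
  by (simp add: complex_eq_iff)

lemma vertex_add_n:
  assumes "n > 0"
  shows "vertex n r (j + n) = - vertex n r j"
proof -
  have "pi / 2 + pi / (2 * real n) - real (j + n) * pi / real n
    = (pi / 2 + pi / (2 * real n) - real j * pi / real n) - pi"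
    using assms by (simp add: field_simps)
  then show ?thesis unfolding vertex_def by (simp only: rcis_minus_pi)
qed

section \<open>Action of the symmetries on sides and labels\<close>

lemma rcis_plus_rcis: "rcis r (c + b) + rcis r (c - b) = complex_of_real (2 * r * cos b) * cis c"
  by (simp add: complex_eq_iff cos_add cos_diff sin_add sin_diff algebra_simps)

lemma rcis_minus_rcis:
  "rcis r (pi / 2 + (c - b)) - rcis r (pi / 2 + (c + b)) = complex_of_real (2 * r * sin b) * cis c"
  by (simp add: complex_eq_iff cos_add cos_diff sin_add sin_diff algebra_simps)

lemma vertex_sum:
  assumes "n > 0"
  shows "vertex n r j + vertex n r (j + 1)
    = complex_of_real (2 * r * cos (pi / (2 * real n))) * cis (pi / 2 - real j * pi / real n)"
proof -
  have a: "pi / 2 + pi / (2 * real n) - real j * pi / real n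
      = (pi / 2 - real j * pi / real n) + pi / (2 * real n)" by simp
  have b: "pi / 2 + pi / (2 * real n) - real (j + 1) * pi / real n
      = (pi / 2 - real j * pi / real n) - pi / (2 * real n)"
    using assms by (simp add: field_simps)
  show ?thesis unfolding vertex_def a b by (rule rcis_plus_rcis)
qed

lemma vertex_diff:
  assumes "n > 0"
  shows "vertex n r (j + 1) - vertex n r j
    = complex_of_real (2 * r * sin (pi / (2 * real n))) * cis (- (real j * pi / real n))"
proof -
  have a: "pi / 2 + pi / (2 * real n) - real j * pi / real n
      = pi / 2 + (- (real j * pi / real n) + pi / (2 * real n))" by simp
  have b: "pi / 2 + pi / (2 * real n) - real (j + 1) * pi / real n
      = pi / 2 + (- (real j * pi / real n) - pi / (2 * real n))"
    using assms by (simp add: field_simps)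
  show ?thesis unfolding vertex_def a b by (rule rcis_minus_rcis)
qed

lemma side_period: "n > 0 \<Longrightarrow> side n r (j + 2 * n) = side n r j"
  using vertex_add_n[of n r "j + n"] vertex_add_n[of n r j]
    vertex_add_n[of n r "j + 1 + n"] vertex_add_n[of n r "j + 1"]
  by (simp add: side_def mult_2 mult_2_right ac_simps)

lemma side_mod: "n > 0 \<Longrightarrow> side n r (j mod (2 * n)) = side n r j"
proof -
  assume n: "n > 0"
  have "side n r (i + 2 * n * k) = side n r i" for i k
  proof (induction k)
    case (Suc k)
    then show ?case using side_period[OF n, of r "i + 2 * n * k"] by (simp add: algebra_simps)
  qed simp
  from this[of "j mod (2 * n)" "j div (2 * n)"] show ?thesis by simp
qed

lemma label_add_n: "label n (j + n) = label n j"
  by (simp add: label_def)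

lemma sides_labelled_label:
  assumes "n > 0"
  shows "sides_labelled n r (label n j) = {side n r j, side n r (j + n)}"
proof
  show "sides_labelled n r (label n j) \<subseteq> {side n r j, side n r (j + n)}"
  proof
    fix s assume "s \<in> sides_labelled n r (label n j)"
    then obtain i where i: "s = side n r i" "i < 2 * n" "i mod n = j mod n"
      by (auto simp: sides_labelled_def label_def)
    have fold_mod: "m mod n = (if m < n then m else m - n)" if "m < 2 * n" for m
      using that by (simp add: mod_if)
    have "j mod (2 * n) < 2 * n" using assms by simp
    moreover have "j mod (2 * n) mod n = i mod n" using i(3) by (simp add: mod_mod_cancel)
    ultimately have "i = j mod (2 * n) \<or> i = j mod (2 * n) + n \<or> i + n = j mod (2 * n)"
      using fold_mod[OF i(2)] fold_mod[of "j mod (2 * n)"] by (auto split: if_splits)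
    then have "i mod (2 * n) = j mod (2 * n) \<or> i mod (2 * n) = (j + n) mod (2 * n)"
    proof (elim disjE)
      assume "i + n = j mod (2 * n)"
      then have "(j + n) mod (2 * n) = (i + n + n) mod (2 * n)" by (metis mod_add_left_eq)
      also have "\<dots> = i mod (2 * n)" by (simp add: mult_2[symmetric] add.assoc)
      finally show ?thesis by simp
    qed (auto simp: mod_add_left_eq)
    then show "s \<in> {side n r j, side n r (j + n)}"
      using side_mod[OF assms, of r i] side_mod[OF assms, of r j] side_mod[OF assms, of r "j + n"] i(1)
      by auto
  qed
  have "side n r i \<in> sides_labelled n r (label n i)" for i
    unfolding sides_labelled_def using side_mod[OF assms, of r i] assms
    by (intro CollectI exI[of _ "i mod (2 * n)"]) (simp add: label_def mod_mod_cancel)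
  from this[of j] this[of "j + n"]
  show "{side n r j, side n r (j + n)} \<subseteq> sides_labelled n r (label n j)"
    by (simp add: label_add_n)
qed

text \<open>Equal segments have equal midpoints, and the midpoints of the sides are distinct multiples
  of unit vectors. This makes the permutation of labels well defined.\<close>

lemma side_eq_imp_label_eq:
  assumes "n > 0" "n \<noteq> 1" "r \<noteq> 0" "side n r i = side n r j"
  shows "label n i = label n j"
proof -
  have cpos: "cos (pi / (2 * real n)) > 0"
    using assms(1,2) by (intro cos_gt_zero) (auto simp: field_simps)
  have "{vertex n r i, vertex n r (i + 1)} = {vertex n r j, vertex n r (j + 1)}"
    using assms(4) by (simp add: side_def)
  then have "vertex n r i + vertex n r (i + 1) = vertex n r j + vertex n r (j + 1)"
    by (auto simp: doubleton_eq_iff)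
  then have "cis (pi / 2 - real i * pi / real n) = cis (pi / 2 - real j * pi / real n)"
    using cpos assms(3) unfolding vertex_sum[OF assms(1)] by simp
  then have "cis ((pi / 2 - real i * pi / real n) - (pi / 2 - real j * pi / real n)) = 1"
    by (simp flip: cis_divide)
  then have "sin ((pi / 2 - real i * pi / real n) - (pi / 2 - real j * pi / real n)) = 0"
    by (simp add: complex_eq_iff)
  then obtain q :: int where
    "(pi / 2 - real i * pi / real n) - (pi / 2 - real j * pi / real n) = of_int q * pi"
    using sin_zero_iff_int2 by metis
  then have "(real j - real i) * pi / real n = of_int q * pi"
    by (simp add: diff_divide_distrib left_diff_distrib)
  then have "(real j - real i) * pi = (of_int q * real n) * pi"
    using assms(1) by (simp add: divide_eq_eq ac_simps)
  then have "real j - real i = of_int q * real n" by simp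
  then have "real_of_int (int j - int i) = real_of_int (q * int n)" by simp
  then have "int j = int i + q * int n" by linarith
  then have "int j mod int n = int i mod int n" by simp
  then show ?thesis by (simp add: label_def del: of_nat_mod flip: of_nat_mod)
qed

text \<open>The index of the image of side \<open>j\<close> under \<open>nu n i\<close>. The natural index is
  \<open>n - (i + 1) div 2 - j\<close> modulo \<open>2 * n\<close> in the odd case; \<open>2 * n\<close> is added so that the subtraction of
  natural numbers is not truncated.\<close>

definition moved_side :: "nat \<Rightarrow> nat \<Rightarrow> nat \<Rightarrow> nat" where
  "moved_side n i j = (if even i then j + i div 2 else 3 * n - (i + 1) div 2 - j)"

lemma nu_odd_rcis: "odd i \<Longrightarrow> nu n i (rcis r a) = rcis r ((real i + 1) * pi / (2 * real n) - a)"
  by (simp add: nu_def rcis_def cis_cnj cis_mult mult.left_commute)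

lemma nu_side:
  assumes "n > 0" "i < 2 * n" "j < 2 * n"
  shows "nu n i ` side n r j = side n r (moved_side n i j)"
proof -
  have lin: "linear (nu n i)"
    by (rule linearI) (auto simp: nu_def algebra_simps scaleR_conv_of_real)
  have image: "nu n i ` side n r j = closed_segment (nu n i (vertex n r j)) (nu n i (vertex n r (j + 1)))"
    unfolding side_def by (rule closed_segment_linear_image[OF lin, symmetric])
  show ?thesis
  proof (cases "even i")
    case True
    then obtain q where q: "i = 2 * q" by (elim evenE)
    have "nu n i (vertex n r m) = vertex n r (m + q)" for m
    proof -
      have "pi / 2 + pi / (2 * real n) - real (m + q) * pi / real n
        = - (real i * pi / (2 * real n)) + (pi / 2 + pi / (2 * real n) - real m * pi / real n)"
        using assms(1) by (simp add: q field_simps)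
      then show ?thesis unfolding vertex_def
        by (simp only: nu_def True rcis_def if_True cis_mult[symmetric] ac_simps)
    qed
    then show ?thesis using True unfolding image by (simp add: side_def moved_side_def q)
  next
    case False
    then obtain q0 where q0: "i = 2 * q0 + 1" by (elim oddE)
    define q where "q = q0 + 1"
    have i: "i + 1 = 2 * q" "q \<le> n" using q0 assms(2) by (auto simp: q_def)
    have iq: "real i = 2 * real q - 1" using i(1) by linarith
    have *: "nu n i (vertex n r m) = vertex n r (3 * n + 1 - q - m)" if "m \<le> 2 * n" for m
    proof -
      have "real (3 * n + 1 - q - m) = 3 * real n + 1 - real q - real m"
        using i that by (simp add: of_nat_diff)
      then have angle: "pi / 2 + pi / (2 * real n) - real (3 * n + 1 - q - m) * pi / real n
        = (real i + 1) * pi / (2 * real n) - (pi / 2 + pi / (2 * real n) - real m * pi / real n) - pi - pi"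
        using assms(1) by (simp add: iq field_simps)
      show ?thesis unfolding vertex_def angle rcis_minus_pi nu_odd_rcis[OF False] by simp
    qed
    have "3 * n + 1 - q - j = Suc (3 * n - q - j)" "3 * n + 1 - q - (j + 1) = 3 * n - q - j"
      "(i + 1) div 2 = q"
      using i assms(3) by auto
    then show ?thesis using False *[of j] *[of "j + 1"] assms(3) unfolding image
      by (simp add: side_def moved_side_def closed_segment_commute)
  qed
qed

lemma label_perm_eq:
  assumes "n > 0" "n \<noteq> 1" "i < 2 * n" "L \<in> {1..n}"
  shows "label_perm n i L = label n (moved_side n i (L - 1))"
proof -
  have L: "L - 1 < 2 * n" "L - 1 + n < 2 * n" using assms(4) by auto
  have "image (nu n i) ` sides_labelled n 1 L
      = {side n 1 (moved_side n i (L - 1)), side n 1 (moved_side n i (L - 1 + n))}"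
    using sides_labelled_label[OF assms(1), of 1 "L - 1"] label_minus_1[OF assms(4)]
      nu_side[OF assms(1,3) L(1), of 1] nu_side[OF assms(1,3) L(2), of 1] by simp
  also have "\<dots> = sides_labelled n 1 (label n (moved_side n i (L - 1)))"
  proof (cases "even i")
    case True
    then have "moved_side n i (L - 1 + n) = moved_side n i (L - 1) + n" by (simp add: moved_side_def)
    then show ?thesis by (simp add: sides_labelled_label[OF assms(1)])
  next
    case False
    then have "(i + 1) div 2 \<le> n" using assms(3) by auto
    then have eq: "moved_side n i (L - 1) = moved_side n i (L - 1 + n) + n"
      using False L by (auto simp: moved_side_def)
    show ?thesis unfolding eq label_add_n sides_labelled_label[OF assms(1)] by blast
  qed
  finally have *: "image (nu n i) ` sides_labelled n 1 L
      = sides_labelled n 1 (label n (moved_side n i (L - 1)))" .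
  show ?thesis unfolding label_perm_def
  proof (rule the_equality)
    fix L' assume L': "L' \<in> {1..n} \<and> image (nu n i) ` sides_labelled n 1 L = sides_labelled n 1 L'"
    have "sides_labelled n 1 (label n (L' - 1)) = sides_labelled n 1 (label n (moved_side n i (L - 1)))"
      using L' * label_minus_1[of L' n] by simp
    then have "side n 1 (L' - 1) \<in> {side n 1 (moved_side n i (L - 1)), side n 1 (moved_side n i (L - 1) + n)}"
      unfolding sides_labelled_label[OF assms(1)] by blast
    then have "label n (L' - 1) = label n (moved_side n i (L - 1))"
      using side_eq_imp_label_eq[OF assms(1,2), of 1] label_add_n by (metis insertE one_neq_zero singletonD)
    then show "L' = label n (moved_side n i (L - 1))" using L' label_minus_1[of L' n] by simp
  qed (use * label_in assms(1) in auto)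
qed

lemma cis_shift: "cis (a + pi + 2 * pi) = - cis a"
  by (simp only: cis_mult[symmetric]) simp

text \<open>The position of the image side relative to the image direction is that of the original
  side relative to the original direction, up to the reflection \<open>z \<mapsto> - cnj z\<close>. That map fixes \<open>Im\<close>
  and negates \<open>Re\<close>, so it reverses heights and keeps exit sides.\<close>

lemma nu_ray:
  assumes "n > 0" "i < 2 * n" "j < n"
  shows "nu n i v * cis (real (moved_side n i j) * pi / real n)
    = (if even i then v * cis (real j * pi / real n) else - cnj (v * cis (real j * pi / real n)))"
proof (cases "even i")
  case True
  then obtain q where q: "i = 2 * q" by (elim evenE)
  have "real (moved_side n i j) * pi / real n = real i * pi / (2 * real n) + real j * pi / real n"
    using assms(1) by (simp add: q moved_side_def field_simps)
  then have "cis (- (real i * pi / (2 * real n))) * cis (real (moved_side n i j) * pi / real n)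
      = cis (real j * pi / real n)"
    by (simp add: cis_mult)
  then show ?thesis using True by (simp add: nu_def mult.assoc mult.left_commute)
next
  case False
  then obtain q0 where q0: "i = 2 * q0 + 1" by (elim oddE)
  define q where "q = q0 + 1"
  have i: "i + 1 = 2 * q" "q \<le> n" using q0 assms(2) by (auto simp: q_def)
  then have "moved_side n i j = 3 * n - q - j" "q + j \<le> 3 * n"
    using False assms(3) by (auto simp: moved_side_def)
  then have moved: "real (moved_side n i j) = 3 * real n - real q - real j"
    by (simp add: of_nat_diff)
  have iq: "real i = 2 * real q - 1" using i(1) by linarith
  have "(real i + 1) * pi / (2 * real n) + real (moved_side n i j) * pi / real n
      = - (real j * pi / real n) + pi + 2 * pi"
    unfolding moved iq using assms(1) by (simp add: field_simps)
  then have "cis ((real i + 1) * pi / (2 * real n)) * cis (real (moved_side n i j) * pi / real n)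
      = - cis (- (real j * pi / real n))"
    unfolding cis_mult by (simp only: cis_shift)
  then show ?thesis using False by (simp add: nu_def cis_cnj mult.assoc mult.left_commute)
qed

lemma label_perm_in:
  assumes "n > 0" "n \<noteq> 1" "i < 2 * n" "L \<in> {1..n}"
  shows "label_perm n i L \<in> {1..n}"
  using label_perm_eq[OF assms] label_in[OF assms(1)] by simp

lemma label_perm_midheight:
  assumes "n > 0" "n \<noteq> 1" "i < 2 * n" "L \<in> {1..n}"
  shows "midheight n (nu n i v) (label_perm n i L) = (if even i then 1 else -1) * midheight n v L"
    and "halfwidth n (nu n i v) (label_perm n i L) = halfwidth n v L"
proof -
  have L: "label n (L - 1) = L" "L - 1 < n" using label_minus_1[OF assms(4)] assms(4) by auto
  define z where "z = v * cis (real (L - 1) * pi / real n)"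
  note new = nu_ray[OF assms(1,3) L(2), of v, folded z_def, symmetric]
  show "midheight n (nu n i v) (label_perm n i L) = (if even i then 1 else -1) * midheight n v L"
    using midheight_label[OF assms(1) z_def] midheight_label[OF assms(1) new] unfolding L(1)
    by (simp add: label_perm_eq[OF assms])
  show "halfwidth n (nu n i v) (label_perm n i L) = halfwidth n v L"
    using halfwidth_label[OF assms(1) z_def] halfwidth_label[OF assms(1) new] unfolding L(1)
    by (simp add: label_perm_eq[OF assms])
qed

lemma label_perm_inj:
  assumes "n > 0" "n \<noteq> 1" "i < 2 * n"
  shows "inj_on (label_perm n i) {1..n}"
proof (rule inj_onI)
  fix L L' assume L: "L \<in> {1..n}" "L' \<in> {1..n}" "label_perm n i L = label_perm n i L'"
  have mods: "moved_side n i (L - 1) mod n = moved_side n i (L' - 1) mod n"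
    using L(3) unfolding label_perm_eq[OF assms L(1)] label_perm_eq[OF assms L(2)] by (simp add: label_def)
  have mods_int: "int (moved_side n i (L - 1)) mod int n = int (moved_side n i (L' - 1)) mod int n"
    using mods by (metis of_nat_mod)
  have "int (L - 1) mod int n = int (L' - 1) mod int n"
  proof (cases "even i")
    case True
    then have "int (L - 1) = int (moved_side n i (L - 1)) - int (i div 2)"
        "int (L' - 1) = int (moved_side n i (L' - 1)) - int (i div 2)"
      by (simp_all add: moved_side_def)
    then show ?thesis using mod_diff_cong[OF mods_int refl] by simp
  next
    case False
    define c where "c = 3 * n - (i + 1) div 2"
    have "L - 1 \<le> c" "L' - 1 \<le> c" using assms(3) L(1,2) by (auto simp: c_def)
    moreover have "moved_side n i j = c - j" for j using False by (simp add: moved_side_def c_def)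
    ultimately have "int (L - 1) = int c - int (moved_side n i (L - 1))"
        "int (L' - 1) = int c - int (moved_side n i (L' - 1))"
      by (simp_all add: of_nat_diff)
    then show ?thesis using mod_diff_cong[OF refl mods_int] by simp
  qed
  then have "(L - 1) mod n = (L' - 1) mod n" by (metis of_nat_mod of_nat_eq_iff)
  then have "label n (L - 1) = label n (L' - 1)" by (simp add: label_def)
  then show "L = L'" using label_minus_1 L(1,2) by simp
qed

text \<open>The equivalence is used in both directions: forwards to move a direction into the standard
  sector, backwards to return from it after the derivation.\<close>

lemma coded_label_perm:
  assumes "n > 0" "n \<noteq> 1" "i < 2 * n" "range w \<subseteq> {1..n}"
  shows "coded n (nu n i v) (label_perm n i \<circ> w) \<longleftrightarrow> coded n v w"
proof
  assume "coded n v w"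
  then show "coded n (nu n i v) (label_perm n i \<circ> w)"
  proof (rule coded_transport)
    show "range (label_perm n i \<circ> w) \<subseteq> {1..n}" 
      using label_perm_in[OF assms(1-3)] assms(4) by auto
  qed (use label_perm_midheight[OF assms(1-3)] in auto)
next
  assume "coded n (nu n i v) (label_perm n i \<circ> w)"
  then obtain x :: "int \<Rightarrow> real" where x:
    "\<And>k. \<bar>x k\<bar> < halfwidth n (nu n i v) (label_perm n i (w k))"
    "\<And>k. x k - x (k + 1) = midheight n (nu n i v) (label_perm n i (w k))
        + midheight n (nu n i v) (label_perm n i (w (k + 1)))"
    unfolding coded_def by auto
  define \<rho> :: real where "\<rho> = (if even i then 1 else -1)"
  have "w k \<in> {1..n}" for k using assms(4) by blast
  note perm = label_perm_midheight[OF assms(1-3) this, of v, folded \<rho>_def]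
  have "\<bar>\<rho> * x k\<bar> < halfwidth n v (w k) \<and>
     \<rho> * x k - \<rho> * x (k + 1) = midheight n v (w k) + midheight n v (w (k + 1))" for k
    using x(1)[of k] x(2)[of k] by (auto simp: perm \<rho>_def)
  then show "coded n v w" using assms(4) unfolding coded_def by (intro conjI exI[of _ "\<lambda>k. \<rho> * x k"]) auto
qed

section \<open>Enumeration of sandwiched letters\<close>

text \<open>The nonnegative and the negative part are both infinite sets of natural numbers, up to
  reflection, and are enumerated separately.\<close>

lemma int_set_enumeration:
  fixes S :: "int set"
  assumes up: "\<And>K. \<exists>k\<ge>K. k \<in> S" and down: "\<And>K. \<exists>k\<le>K. k \<in> S"
  obtains f :: "int \<Rightarrow> int" where "strict_mono f" "range f = S"
proof -
  define A where "A = {m::nat. int m \<in> S}"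
  define B where "B = {m::nat. - 1 - int m \<in> S}"
  have "\<exists>m\<ge>K. m \<in> A" for K
    using up[of "int K"] by (metis A_def mem_Collect_eq nat_int_comparison(3) of_nat_0_le_iff order_trans zero_le_imp_eq_int)
  then have A: "infinite A" by (meson finite_nat_set_iff_bounded_le not_less_eq_eq)
  have "\<exists>m\<ge>K. m \<in> B" for K
  proof -
    obtain k where "k \<le> - 1 - int K" "k \<in> S" using down by blast
    then show ?thesis by (intro exI[of _ "nat (- 1 - k)"]) (auto simp: B_def)
  qed
  then have B: "infinite B" by (meson finite_nat_set_iff_bounded_le not_less_eq_eq)
  define f where "f k = (if k \<ge> 0 then int (enumerate A (nat k))
      else - 1 - int (enumerate B (nat (- 1 - k))))" for k :: int
  show ?thesis
  proof
    show "strict_mono f"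
    proof (rule strict_monoI)
      fix a b :: int assume ab: "a < b"
      consider "a \<ge> 0" | "a < 0" "b \<ge> 0" | "b < 0" by linarith
      then show "f a < f b"
      proof cases
        case 1
        then show ?thesis using ab enumerate_mono[OF _ A, of "nat a" "nat b"] by (simp add: f_def)
      next
        case 2
        then show ?thesis by (simp add: f_def)
      next
        case 3
        then show ?thesis using ab enumerate_mono[OF _ B, of "nat (- 1 - b)" "nat (- 1 - a)"]
          by (simp add: f_def)
      qed
    qed
    show "range f = S"
    proof
      show "range f \<subseteq> S"
        using enumerate_in_set[OF A] enumerate_in_set[OF B] by (auto simp: f_def A_def B_def)
      show "S \<subseteq> range f"
      proof
        fix s assume s: "s \<in> S"
        show "s \<in> range f"
        proof (cases "s \<ge> 0")
          case True
          then obtain m where "enumerate A m = nat s"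
            using enumerate_Ex[OF A, of "nat s"] s by (auto simp: A_def)
          then have "f (int m) = s" using True by (simp add: f_def)
          then show ?thesis by blast
        next
          case False
          then obtain m where "enumerate B m = nat (- 1 - s)"
            using enumerate_Ex[OF B, of "nat (- 1 - s)"] s by (auto simp: B_def)
          then have "f (- 1 - int m) = s" using False by (simp add: f_def)
          then show ?thesis by blast
        qed
      qed
    qed
  qed
qed

text \<open>In diagram \<open>0\<close> two consecutive transitions have the same label sum exactly when the letter
  between them is sandwiched. Without sandwiched letters the two possible sums \<open>n + 1\<close> and \<open>n + 2\<close>
  alternate, so every second letter changes by a constant \<open>\<plusminus>1\<close> and leaves \<open>{1..n}\<close> after \<open>2 * n\<close>
  steps.\<close>

lemma sandwiched_bounded_gap:
  assumes "admissible0 n w"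
  shows "\<exists>k\<in>{K..K + 2 * int n}. sandwiched w k"
proof (rule ccontr)
  assume none: "\<not> ?thesis"
  define D where "D k = int (w (k + 2)) - int (w k)" for k
  have "w k + w (k + 1) = n + 1 \<or> w k + w (k + 1) = n + 2" for k
    using assms unfolding admissible0_def by blast
  note sum = this
  have "int (w k) + int (w (k + 1)) = int n + 1 \<or> int (w k) + int (w (k + 1)) = int n + 2" for k
    using sum[of k] by presburger
  then have adm: "int (w k) + int (w (k + 1)) \<in> {int n + 1, int n + 2}" for k
    by blast
  have D: "D k \<in> {-1, 1}" "D (k + 1) = - D k" if "K \<le> k" "k + 2 \<le> K + 2 * int n" for k
  proof -
    have "w k \<noteq> w (k + 2)" "w (k + 1) \<noteq> w (k + 3)"
      using none that unfolding sandwiched_def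
      by (force dest: bspec[of _ _ "k + 1"] bspec[of _ _ "k + 2"] simp: ac_simps)+
    then show "D k \<in> {-1, 1}" "D (k + 1) = - D k"
      using adm[of k] adm[of "k + 1"] adm[of "k + 2"] by (auto simp: D_def ac_simps)
  qed
  have walk: "int (w (K + 2 * int m)) = int (w K) + int m * D K \<and> (m < n \<longrightarrow> D (K + 2 * int m) = D K)"
    if "m \<le> n" for m
    using that
  proof (induction m)
    case (Suc m)
    have "D (K + 2 * int m + 1 + 1) = D (K + 2 * int m)" if "Suc m < n"
      using D(2)[of "K + 2 * int m + 1"] D(2)[of "K + 2 * int m"] that by simp
    then show ?case using Suc unfolding D_def by (auto simp: algebra_simps)
  qed simp
  have range: "int (w k) \<in> {1..int n}" for k using assms unfolding admissible0_def by force
  have "n > 0" using range[of 0] by auto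
  then have "D K \<in> {-1, 1}" using D(1)[of K] by simp
  then show False using walk[of n] range[of K] range[of "K + 2 * int n"] by auto
qed

lemma sandwiched_enumeration:
  assumes "admissible0 n w"
  obtains f :: "int \<Rightarrow> int" where "strict_mono f" "range f = {k. sandwiched w k}"
proof (rule int_set_enumeration[of "{k. sandwiched w k}"])
  show "\<exists>k\<ge>K. k \<in> {k. sandwiched w k}" for K using sandwiched_bounded_gap[OF assms, of K] by auto
  show "\<exists>k\<le>K. k \<in> {k. sandwiched w k}" for K
    using sandwiched_bounded_gap[OF assms, of "K - 2 * int n"] by auto
qed

section \<open>Transitions in the standard sector\<close>

text \<open>The \<open>2 * n\<close> isometries together with the central symmetry are the whole dihedral group, which
  acts transitively on the \<open>4 * n\<close> sectors of angle \<open>pi / (2 * n)\<close>.\<close>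

lemma sector_representative:
  assumes "n > 0" "v \<noteq> 0"
  obtains i u \<phi> \<rho> where "i < 2 * n" "u = v \<or> u = - v" "nu n i u = rcis \<rho> \<phi>"
    "\<rho> > 0" "0 \<le> \<phi>" "\<phi> \<le> pi / (2 * real n)"
proof -
  define \<beta> where "\<beta> = pi / (2 * real n)"
  have \<beta>: "\<beta> > 0" "2 * real n * \<beta> = pi" using assms(1) by (auto simp: \<beta>_def)
  have "\<exists>u \<theta>. (u = v \<or> u = - v) \<and> u = rcis (cmod v) \<theta> \<and> 0 \<le> \<theta> \<and> \<theta> < pi"
  proof -
    have v: "rcis (cmod v) (Arg v) = v" by (rule rcis_cmod_Arg)
    have "- pi < Arg v" "Arg v \<le> pi" using Arg_bounded by auto
    then consider "Arg v < 0" "0 < Arg v + pi" | "0 \<le> Arg v" "Arg v < pi" | "Arg v = pi" by linarith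
    then show ?thesis
    proof cases
      case 1
      have "rcis (cmod v) (Arg v + pi) = - v" using v by (simp add: complex_eq_iff)
      then show ?thesis using 1 by (intro exI[of _ "- v"] exI[of _ "Arg v + pi"]) simp
    next
      case 2
      then show ?thesis using v by (intro exI[of _ v] exI[of _ "Arg v"]) simp
    next
      case 3
      then have "rcis (cmod v) 0 = - v" using v by (simp add: complex_eq_iff)
      then show ?thesis by (intro exI[of _ "- v"] exI[of _ 0]) simp
    qed
  qed
  then obtain u \<theta> where u: "u = v \<or> u = - v" "u = rcis (cmod v) \<theta>" "0 \<le> \<theta>" "\<theta> < pi" by blast
  define i where "i = nat \<lfloor>\<theta> / \<beta>\<rfloor>"
  have i: "real i \<le> \<theta> / \<beta>" "\<theta> / \<beta> < real i + 1"
    using u(3) \<beta>(1) floor_correct[of "\<theta> / \<beta>"] unfolding i_def by (auto simp: add.commute)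
  then have i': "real i * \<beta> \<le> \<theta>" "\<theta> < (real i + 1) * \<beta>" using \<beta>(1) by (auto simp: field_simps)
  have "real i * \<beta> < (2 * real n) * \<beta>" using i'(1) u(4) \<beta>(2) by linarith
  then have "i < 2 * n" using \<beta>(1) by (metis mult_less_cancel_right_pos of_nat_less_iff of_nat_mult of_nat_numeral)
  define \<phi> where "\<phi> = (if even i then \<theta> - real i * \<beta> else (real i + 1) * \<beta> - \<theta>)"
  have \<phi>: "0 \<le> \<phi>" "\<phi> \<le> \<beta>" using i' by (auto simp: \<phi>_def algebra_simps)
  have "nu n i (rcis (cmod v) \<theta>) = rcis (cmod v) \<phi>"
    by (simp add: nu_def rcis_def \<beta>_def \<phi>_def cis_cnj cis_mult mult.left_commute)
  then show ?thesis
    using that[OF \<open>i < 2 * n\<close> u(1)] u(2) \<phi> assms(2) unfolding \<beta>_def by simp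
qed

text \<open>With \<open>A\<close> and \<open>A'\<close> the angles of the two rays and \<open>S\<close> their mean, the assumption becomes
  \<open>\<bar>cos S\<bar> < tan (pi / (2 * n)) * sin S\<close>: the common factor \<open>cos ((A - A') / 2)\<close> from the sum formulas
  is positive. So \<open>S\<close> is closer than \<open>pi / (2 * n)\<close> to \<open>pi / 2\<close>, and \<open>S\<close> depends on the labels only
  through their sum.\<close>

lemma sector_transition:
  assumes n: "n > 1" and \<rho>: "\<rho> > 0" and \<phi>: "0 \<le> \<phi>" "\<phi> \<le> pi / (2 * real n)"
    and L: "L \<in> {1..n}" "L' \<in> {1..n}"
    and near: "\<bar>midheight n (rcis \<rho> \<phi>) L + midheight n (rcis \<rho> \<phi>) L'\<bar>
      < halfwidth n (rcis \<rho> \<phi>) L + halfwidth n (rcis \<rho> \<phi>) L'"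
    and pos: "halfwidth n (rcis \<rho> \<phi>) L > 0" "halfwidth n (rcis \<rho> \<phi>) L' > 0"
  shows "L + L' \<in> {n + 1, n + 2}"
proof -
  define \<beta> where "\<beta> = pi / (2 * real n)"
  have \<beta>: "\<beta> > 0" "2 * real n * \<beta> = pi" "\<beta> < pi / 2" using n by (auto simp: \<beta>_def field_simps)
  define A where "A M = \<phi> + 2 * (real M - 1) * \<beta>" for M :: nat
  have "\<phi> + (real M - 1) * pi / real n = A M" for M
    using n by (simp add: A_def \<beta>_def field_simps)
  then have "ray n (rcis \<rho> \<phi>) M = rcis \<rho> (A M)" for M
    by (simp add: ray_def rcis_def mult.assoc cis_mult)
  then have ray: "Re (ray n (rcis \<rho> \<phi>) M) = \<rho> * cos (A M)" "Im (ray n (rcis \<rho> \<phi>) M) = \<rho> * sin (A M)" for M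
    by simp_all
  have A: "0 \<le> A M" "A M < pi" if "M \<in> {1..n}" for M
  proof -
    show "0 \<le> A M" using that \<beta>(1) \<phi>(1) unfolding A_def by simp
    have "real M * \<beta> \<le> real n * \<beta>" using that \<beta>(1) by (intro mult_right_mono) auto
    moreover have "A M = \<phi> + 2 * (real M * \<beta>) - 2 * \<beta>" by (simp add: A_def algebra_simps)
    moreover have "\<phi> \<le> \<beta>" "2 * (real n * \<beta>) = pi" using \<phi>(2) n by (simp_all add: \<beta>_def)
    ultimately show "A M < pi" using \<beta>(1) by linarith
  qed
  have "sin (A L) \<ge> 0" "sin (A L') \<ge> 0" by (intro sin_ge_zero less_imp_le[OF A(2)] A(1) L)+
  then have "sin (A L) > 0" "sin (A L') > 0"
    using pos unfolding halfwidth_def ray by (auto simp: less_le)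
  then have "\<bar>\<rho> * cos (A L) + \<rho> * cos (A L')\<bar> < tan \<beta> * (\<rho> * sin (A L)) + tan \<beta> * (\<rho> * sin (A L'))"
    using near \<rho> unfolding midheight_def halfwidth_def ray \<beta>_def[symmetric] by (simp add: sgn_mult abs_mult)
  moreover have "\<bar>\<rho> * cos (A L) + \<rho> * cos (A L')\<bar> = \<rho> * \<bar>cos (A L) + cos (A L')\<bar>"
    using \<rho> by (simp add: abs_mult flip: distrib_left)
  moreover have "tan \<beta> * (\<rho> * sin (A L)) + tan \<beta> * (\<rho> * sin (A L'))
      = \<rho> * (tan \<beta> * (sin (A L) + sin (A L')))"
    by (simp add: algebra_simps)
  ultimately have lt: "\<bar>cos (A L) + cos (A L')\<bar> < tan \<beta> * (sin (A L) + sin (A L'))"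
    using \<rho> by simp
  define S where "S = (A L + A L') / 2"
  define E where "E = cos ((A L - A L') / 2)"
  have "E > 0" unfolding E_def using A[OF L(1)] A[OF L(2)] by (intro cos_gt_zero_pi) auto
  have "cos \<beta> > 0" using \<beta> by (intro cos_gt_zero) auto
  have "\<bar>2 * E * cos S\<bar> < tan \<beta> * (2 * E * sin S)"
    using lt unfolding cos_plus_cos sin_plus_sin S_def E_def by (simp add: ac_simps)
  then have "2 * E * \<bar>cos S\<bar> < 2 * E * (tan \<beta> * sin S)" using \<open>E > 0\<close> by (simp add: abs_mult ac_simps)
  then have "\<bar>cos S\<bar> < tan \<beta> * sin S" using \<open>E > 0\<close> by simp
  then have "\<bar>cos S\<bar> * cos \<beta> < sin \<beta> * sin S"
    using \<open>cos \<beta> > 0\<close> by (simp add: tan_def field_simps)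
  moreover have "cos S * cos \<beta> \<le> \<bar>cos S\<bar> * cos \<beta>" "- cos S * cos \<beta> \<le> \<bar>cos S\<bar> * cos \<beta>"
    using \<open>cos \<beta> > 0\<close> by (intro mult_right_mono; simp)+
  ultimately have "cos S * cos \<beta> < sin \<beta> * sin S" "- cos S * cos \<beta> < sin \<beta> * sin S" by linarith+
  then have cs: "cos (S + \<beta>) < 0" "cos (S - \<beta>) > 0" by (auto simp: cos_add cos_diff ac_simps)
  have S: "0 \<le> S" "S < pi" using A[OF L(1)] A[OF L(2)] by (auto simp: S_def)
  have "S + \<beta> > pi / 2"
  proof (rule ccontr)
    assume "\<not> S + \<beta> > pi / 2"
    then show False using cs(1) S(1) \<beta>(1) cos_ge_zero[of "S + \<beta>"] by simp
  qed
  moreover have "S - \<beta> < pi / 2"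
  proof (rule ccontr)
    assume "\<not> S - \<beta> < pi / 2"
    then show False using cs(2) S(2) \<beta>(1) cos_ge_zero[of "pi - (S - \<beta>)"] unfolding cos_pi_minus by simp
  qed
  moreover have "S = \<phi> + (real (L + L') - 2) * \<beta>" by (simp add: S_def A_def field_simps)
  moreover have "pi / 2 = real n * \<beta>" using \<beta>(2) by simp
  ultimately have "real n * \<beta> < real (L + L') * \<beta>" "(real (L + L') - 3) * \<beta> < real n * \<beta>"
    using \<phi> unfolding \<beta>_def[symmetric] by (auto simp: algebra_simps)
  then have "real n < real (L + L')" "real (L + L') - 3 < real n" using \<beta>(1) by auto
  then show ?thesis by auto
qed

lemma sector_admissible0:
  assumes "n > 1" "coded n (rcis \<rho> \<phi>) w" "\<rho> > 0" "0 \<le> \<phi>" "\<phi> \<le> pi / (2 * real n)"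
  shows "admissible0 n w"
proof -
  have w: "w k \<in> {1..n}" for k using assms(2) unfolding coded_def by blast
  obtain x :: "int \<Rightarrow> real" where
    x: "\<forall>k. \<bar>x k\<bar> < halfwidth n (rcis \<rho> \<phi>) (w k) \<and>
       x k - x (k + 1) = midheight n (rcis \<rho> \<phi>) (w k) + midheight n (rcis \<rho> \<phi>) (w (k + 1))"
    using assms(2) unfolding coded_def by (elim conjE exE)
  have "w k + w (k + 1) \<in> {n + 1, n + 2}" for k
  proof (rule sector_transition[OF assms(1,3-5) w w])
    have bounds: "\<bar>x k\<bar> < halfwidth n (rcis \<rho> \<phi>) (w k)"
      "\<bar>x (k + 1)\<bar> < halfwidth n (rcis \<rho> \<phi>) (w (k + 1))" using x by blast+
    then show "halfwidth n (rcis \<rho> \<phi>) (w k) > 0" "halfwidth n (rcis \<rho> \<phi>) (w (k + 1)) > 0"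
      by (meson abs_ge_zero le_less_trans)+
    show "\<bar>midheight n (rcis \<rho> \<phi>) (w k) + midheight n (rcis \<rho> \<phi>) (w (k + 1))\<bar>
      < halfwidth n (rcis \<rho> \<phi>) (w k) + halfwidth n (rcis \<rho> \<phi>) (w (k + 1))"
      using bounds x[rule_format, of k] by linarith
  qed
  then show ?thesis using w unfolding admissible0_def by blast
qed

section \<open>Derivation in the standard sector\<close>

text \<open>The involution with matrix \<open>(-1, 2 * cot (pi / (2 * n)); 0, 1)\<close>, the derivative of an affine
  automorphism of the glued polygon that shears its horizontal cylinders. It maps the sector of
  angles \<open>[0, pi / (2 * n)]\<close> onto \<open>[pi / (2 * n), pi]\<close>.\<close>

definition veech :: "nat \<Rightarrow> complex \<Rightarrow> complex" where
  "veech n v = Complex (2 * cot (pi / (2 * real n)) * Im v - Re v) (Im v)"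

text \<open>The sides at the angles \<open>a\<close> and \<open>b\<close> carry labels with sum \<open>n + 1\<close>. The first identity locates
  the end of the exit side at \<open>b\<close>, seen from the midpoint of the side at \<open>a\<close>; it is
  the end of the transformed side. The second one says that the transformation negates the
  displacement of such a transition.\<close>

lemma veech_step_up:
  assumes "n > 1" "b = pi - pi / real n - a"
  shows "Re (v * cis a) + Re (v * cis b) - tan (pi / (2 * real n)) * Im (v * cis b)
      = - (tan (pi / (2 * real n)) * Im (veech n v * cis a))"
    and "Re (veech n v * cis a) + Re (veech n v * cis b) = - (Re (v * cis a) + Re (v * cis b))"
proof -
  define \<beta> where "\<beta> = pi / (2 * real n)"
  have \<beta>: "0 < \<beta>" "\<beta> < pi / 2" using assms(1) by (auto simp: \<beta>_def field_simps)
  have pos: "cos \<beta> > 0" "sin \<beta> > 0" using \<beta> by (auto intro: cos_gt_zero sin_gt_zero)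
  have sq: "sin \<beta> * sin \<beta> = 1 - cos \<beta> * cos \<beta>" using sin_squared_eq[of \<beta>] by (simp add: power2_eq_square)
  have b: "b = pi - (a + 2 * \<beta>)" using assms(1) by (simp add: assms(2) \<beta>_def field_simps)
  have "cos b = - cos (a + 2 * \<beta>)" "sin b = sin (a + 2 * \<beta>)" by (simp_all only: b cos_pi_minus sin_pi_minus)
  then have cosb: "cos b = 2 * sin a * sin \<beta> * cos \<beta> - cos a * (2 * cos \<beta> * cos \<beta> - 1)"
    and sinb: "sin b = sin a * (2 * cos \<beta> * cos \<beta> - 1) + 2 * cos a * sin \<beta> * cos \<beta>"
    by (simp_all only: cos_add sin_add cos_double_cos sin_double) (simp_all add: power2_eq_square algebra_simps)
  have tan: "tan \<beta> = sin \<beta> / cos \<beta>" and cot: "cot \<beta> = cos \<beta> / sin \<beta>" by (simp_all add: tan_def cot_def)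
  show "Re (v * cis a) + Re (v * cis b) - tan (pi / (2 * real n)) * Im (v * cis b)
      = - (tan (pi / (2 * real n)) * Im (veech n v * cis a))"
    unfolding veech_def \<beta>_def[symmetric] tan cot
    using pos sq by (simp add: cosb sinb divide_simps) algebra
  show "Re (veech n v * cis a) + Re (veech n v * cis b) = - (Re (v * cis a) + Re (v * cis b))"
    unfolding veech_def \<beta>_def[symmetric] tan cot
    using pos sq by (simp add: cosb sinb divide_simps) algebra
qed

text \<open>The companion for labels with sum \<open>n + 2\<close>: the other end of the exit side matters, and the
  displacement is kept.\<close>

lemma veech_step_down:
  assumes "n > 1" "b = pi - a"
  shows "Re (v * cis a) + Re (v * cis b) + tan (pi / (2 * real n)) * Im (v * cis b)
      = - (tan (pi / (2 * real n)) * Im (veech n v * cis a))"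
    and "Re (veech n v * cis a) + Re (veech n v * cis b) = Re (v * cis a) + Re (v * cis b)"
proof -
  define \<beta> where "\<beta> = pi / (2 * real n)"
  have \<beta>: "0 < \<beta>" "\<beta> < pi / 2" using assms(1) by (auto simp: \<beta>_def field_simps)
  have pos: "cos \<beta> > 0" "sin \<beta> > 0" using \<beta> by (auto intro: cos_gt_zero sin_gt_zero)
  have tan: "tan \<beta> = sin \<beta> / cos \<beta>" and cot: "cot \<beta> = cos \<beta> / sin \<beta>" by (simp_all add: tan_def cot_def)
  have b: "cos b = - cos a" "sin b = sin a" by (simp_all add: assms(2))
  show "Re (v * cis a) + Re (v * cis b) + tan (pi / (2 * real n)) * Im (v * cis b)
      = - (tan (pi / (2 * real n)) * Im (veech n v * cis a))"
    unfolding veech_def \<beta>_def[symmetric] tan cot using pos by (simp add: b field_simps)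
  show "Re (veech n v * cis a) + Re (veech n v * cis b) = Re (v * cis a) + Re (v * cis b)"
    by (simp add: veech_def b)
qed

text \<open>Call a transition up if its labels add to \<open>n + 1\<close> and down if they add to \<open>n + 2\<close>. Write \<open>\<tau>\<close> for
  \<open>tan (pi / (2 * n))\<close> and \<open>y' k\<close> for the imaginary part of the transformed ray. The ends of
  the sides are such that a transition up from letter \<open>k\<close> forces \<open>x k > - \<tau> y' k\<close> and a transition up
  into it forces \<open>x k < \<tau> y' k\<close>, with the opposite inequalities for down. A letter is sandwiched
  when both of its transitions have the same kind, and then \<open>\<bar>x k\<bar> < \<tau> * \<bar>y' k\<bar>\<close>: the line meets the
  transformed side with that label, and the kind is the sign of \<open>y' k\<close>. The transformed midpoint heights
  reproduce, up to the kind \<open>s k\<close>, every displacement \<open>x (k + 1) - x k\<close>. Between two sandwiched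
  letters the kinds alternate, so the sum of these displacements telescopes, and only the two end
  terms remain. This is the recursion for the direction \<open>veech n v\<close> with the heights \<open>- x\<close>.\<close>

lemma sector_derived_coded:
  assumes n: "n > 1" and code: "coded n (rcis \<rho> \<phi>) w"
    and sector: "\<rho> > 0" "0 \<le> \<phi>" "\<phi> \<le> pi / (2 * real n)"
    and f: "strict_mono f" "range f = {k. sandwiched w k}"
  shows "coded n (veech n (rcis \<rho> \<phi>)) (w \<circ> f)"
proof -
  define \<tau> where "\<tau> = tan (pi / (2 * real n))"
  define v where "v = rcis \<rho> \<phi>"
  define y where "y k = Im (ray n v (w k))" for k
  define m where "m k = Re (ray n v (w k))" for k
  define y' where "y' k = Im (ray n (veech n v) (w k))" for k
  define m' where "m' k = Re (ray n (veech n v) (w k))" for k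
  have w: "w k \<in> {1..n}" for k using code unfolding coded_def by blast
  have adm: "w k + w (k + 1) = n + 1 \<or> w k + w (k + 1) = n + 2" for k
    using sector_admissible0[OF n code sector] unfolding admissible0_def by blast
  have "0 < \<tau>" unfolding \<tau>_def using n by (intro tan_gt_zero) (auto simp: field_simps)
  \<comment> \<open>In the sector the sides \<open>0, ..., n - 1\<close> are never entrance sides, so the signs in the code are positive.\<close>
  have y_nonneg: "0 \<le> y k" for k
  proof -
    have "real (w k) * pi / real n \<le> pi" using w[of k] n by (simp add: field_simps)
    moreover have "pi / real n = 2 * (pi / (2 * real n))" by simp
    moreover have "0 < pi / (2 * real n)" using n by simp
    moreover have "(real (w k) - 1) * pi / real n = real (w k) * pi / real n - pi / real n"
      by (simp add: left_diff_distrib diff_divide_distrib)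
    ultimately have "\<phi> + (real (w k) - 1) * pi / real n \<le> pi" using sector(3) by linarith
    moreover have "0 \<le> \<phi> + (real (w k) - 1) * pi / real n" using sector(2) w[of k] by simp
    moreover have "y k = \<rho> * sin (\<phi> + (real (w k) - 1) * pi / real n)"
      by (simp add: y_def v_def ray_def rcis_def mult.assoc cis_mult)
    ultimately show ?thesis using sector(1) by (simp add: sin_ge_zero)
  qed
  obtain x :: "int \<Rightarrow> real" where
    x0: "\<forall>k. \<bar>x k\<bar> < halfwidth n v (w k) \<and>
       x k - x (k + 1) = midheight n v (w k) + midheight n v (w (k + 1))"
    using code unfolding coded_def v_def by (elim conjE exE)
  have y_pos: "0 < y k" and x_bound: "\<bar>x k\<bar> < \<tau> * y k" for k
  proof -
    have "\<bar>x k\<bar> < \<tau> * \<bar>y k\<bar>" using x0 by (simp add: halfwidth_def \<tau>_def y_def)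
    then show "\<bar>x k\<bar> < \<tau> * y k" using y_nonneg[of k] by simp
    then have "0 < \<tau> * y k" by (meson abs_ge_zero le_less_trans)
    then show "0 < y k" using \<open>0 < \<tau>\<close> by (simp add: zero_less_mult_iff)
  qed
  have x_step: "x k - x (k + 1) = m k + m (k + 1)" for k
    using x0 y_pos[of k] y_pos[of "k + 1"] by (simp add: midheight_def y_def m_def)
  define s :: "int \<Rightarrow> real" where "s k = (if w k + w (k + 1) = n + 1 then 1 else - 1)" for k
  have up: "x k > - (\<tau> * y' k)" "x (k + 1) < \<tau> * y' (k + 1)"
      "x (k + 1) - x k = s k * (m' k + m' (k + 1))" if "w k + w (k + 1) = n + 1" for k
  proof -
    define a where "a = (real (w k) - 1) * pi / real n"
    define b where "b = (real (w (k + 1)) - 1) * pi / real n"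
    have "real (w k) + real (w (k + 1)) = real n + 1" using that by (simp flip: of_nat_add)
    then have next_w: "real (w (k + 1)) = real n + 1 - real (w k)" by linarith
    have ab: "b = pi - pi / real n - a" "a = pi - pi / real n - b"
      unfolding a_def b_def next_w using n by (simp_all add: field_simps)
    have ray: "ray n u (w k) = u * cis a" "ray n u (w (k + 1)) = u * cis b" for u
      by (simp_all add: ray_def a_def b_def)
    have "m k + m (k + 1) - \<tau> * y (k + 1) = - (\<tau> * y' k)"
      using veech_step_up(1)[OF n ab(1), of v] by (simp only: m_def y_def y'_def \<tau>_def ray)
    then show "x k > - (\<tau> * y' k)" using x_step[of k] x_bound[of "k + 1"] by linarith
    have "m (k + 1) + m k - \<tau> * y k = - (\<tau> * y' (k + 1))"
      using veech_step_up(1)[OF n ab(2), of v] by (simp only: m_def y_def y'_def \<tau>_def ray)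
    then show "x (k + 1) < \<tau> * y' (k + 1)" using x_step[of k] x_bound[of k] by linarith
    have "m' k + m' (k + 1) = - (m k + m (k + 1))"
      using veech_step_up(2)[OF n ab(1), of v] by (simp only: m_def m'_def ray)
    then show "x (k + 1) - x k = s k * (m' k + m' (k + 1))"
      using x_step[of k] that by (simp add: s_def)
  qed
  have down: "x k < - (\<tau> * y' k)" "x (k + 1) > \<tau> * y' (k + 1)"
      "x (k + 1) - x k = s k * (m' k + m' (k + 1))" if "w k + w (k + 1) = n + 2" for k
  proof -
    define a where "a = (real (w k) - 1) * pi / real n"
    define b where "b = (real (w (k + 1)) - 1) * pi / real n"
    have "real (w k) + real (w (k + 1)) = real n + 2" using that by (simp flip: of_nat_add)
    then have next_w: "real (w (k + 1)) = real n + 2 - real (w k)" by linarith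
    have ab: "b = pi - a" "a = pi - b"
      unfolding a_def b_def next_w using n by (simp_all add: field_simps)
    have ray: "ray n u (w k) = u * cis a" "ray n u (w (k + 1)) = u * cis b" for u
      by (simp_all add: ray_def a_def b_def)
    have "m k + m (k + 1) + \<tau> * y (k + 1) = - (\<tau> * y' k)"
      using veech_step_down(1)[OF n ab(1), of v] by (simp only: m_def y_def y'_def \<tau>_def ray)
    then show "x k < - (\<tau> * y' k)" using x_step[of k] x_bound[of "k + 1"] by linarith
    have "m (k + 1) + m k + \<tau> * y k = - (\<tau> * y' (k + 1))"
      using veech_step_down(1)[OF n ab(2), of v] by (simp only: m_def y_def y'_def \<tau>_def ray)
    then show "x (k + 1) > \<tau> * y' (k + 1)" using x_step[of k] x_bound[of k] by linarith
    have "m' k + m' (k + 1) = m k + m (k + 1)"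
      using veech_step_down(2)[OF n ab(1), of v] by (simp only: m_def m'_def ray)
    then show "x (k + 1) - x k = s k * (m' k + m' (k + 1))"
      using x_step[of k] that by (simp add: s_def)
  qed
  have s_step: "x (k + 1) - x k = s k * (m' k + m' (k + 1))" for k
    using adm[of k] up(3) down(3) by blast
  have turn: "\<bar>x k\<bar> < \<tau> * \<bar>y' k\<bar> \<and> s (k - 1) = sgn (y' k) \<and> s k = sgn (y' k)" if "sandwiched w k" for k
  proof -
    have eq: "w (k - 1) = w (k + 1)" using that by (simp add: sandwiched_def)
    from adm[of k] show ?thesis
    proof
      assume h: "w k + w (k + 1) = n + 1"
      then have "- (\<tau> * y' k) < x k" "x k < \<tau> * y' k"
        using up(1)[of k] up(2)[of "k - 1"] eq by simp_all
      moreover from this have "0 < \<tau> * y' k" by linarith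
      then have "0 < y' k" using \<open>0 < \<tau>\<close> by (simp add: zero_less_mult_iff)
      ultimately show ?thesis using h eq by (simp add: s_def add.commute abs_less_iff)
    next
      assume h: "w k + w (k + 1) = n + 2"
      then have "x k < - (\<tau> * y' k)" "\<tau> * y' k < x k"
        using down(1)[of k] down(2)[of "k - 1"] eq by simp_all
      moreover from this have "\<tau> * y' k < 0" by linarith
      then have "y' k < 0" using \<open>0 < \<tau>\<close> by (simp add: mult_less_0_iff)
      ultimately show ?thesis using h eq by (simp add: s_def add.commute abs_less_iff)
    qed
  qed
  have alternate: "s k = - s (k - 1)" if "\<not> sandwiched w k" for k
    using that adm[of k] adm[of "k - 1"] by (auto simp: sandwiched_def s_def)
  have "x (f k) + s (f k) * m' (f k) = x (f (k + 1)) - s (f (k + 1)) * m' (f (k + 1))" for k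
  proof -
    have lt: "f k < f (k + 1)" using f(1) by (simp add: strict_monoD)
    have gap: "\<not> sandwiched w i" if "f k < i" "i < f (k + 1)" for i
    proof
      assume "sandwiched w i"
      then obtain l where "i = f l" using f(2) by blast
      then have "k < l" "l < k + 1" using that f(1) by (simp_all add: strict_mono_less)
      then show False by simp
    qed
    \<comment> \<open>The telescoping: this quantity is constant until the next sandwiched letter.\<close>
    have G: "x i + s i * m' i = x (f k) + s (f k) * m' (f k)" if "f k \<le> i" "i < f (k + 1)" for i
      using that
    proof (induction i rule: int_ge_induct)
      case (step i)
      have "s (i + 1) = - s i" using alternate[OF gap[of "i + 1"]] step by simp
      then have "x (i + 1) + s (i + 1) * m' (i + 1) = x i + s i * m' i"
        using s_step[of i] by (simp add: algebra_simps)
      then show ?case using step by simp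
    qed simp
    define e where "e = f (k + 1) - 1"
    have "x e + s e * m' e = x (f k) + s (f k) * m' (f k)" using G[of e] lt by (simp add: e_def)
    moreover have "x (e + 1) - x e = s e * m' e + s e * m' (e + 1)" 
      using s_step[of e] by (simp add: distrib_left)
    moreover have "sandwiched w (e + 1)" using f(2) by (auto simp: e_def)
    then have "s e = s (e + 1)" using turn[of "e + 1"] by simp
    ultimately show ?thesis by (simp add: e_def)
  qed
  then have "- x (f k) - - x (f (k + 1)) = midheight n (veech n v) (w (f k)) + midheight n (veech n v) (w (f (k + 1)))" for k
  proof -
    have "sandwiched w (f j)" for j using f(2) by blast
    then have "midheight n (veech n v) (w (f j)) = s (f j) * m' (f j)" for j
      using turn[of "f j"] by (simp add: midheight_def m'_def y'_def)
    then show ?thesis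
      using \<open>x (f k) + s (f k) * m' (f k) = x (f (k + 1)) - s (f (k + 1)) * m' (f (k + 1))\<close> by simp
  qed
  moreover have "\<bar>- x (f k)\<bar> < halfwidth n (veech n v) (w (f k))" for k
    using turn[of "f k"] f(2) by (auto simp: halfwidth_def \<tau>_def y'_def)
  ultimately have "\<forall>k. \<bar>- x (f k)\<bar> < halfwidth n (veech n v) ((w \<circ> f) k) \<and>
      - x (f k) - - x (f (k + 1))
        = midheight n (veech n v) ((w \<circ> f) k) + midheight n (veech n v) ((w \<circ> f) (k + 1))"
    unfolding comp_def by blast
  moreover have "range (w \<circ> f) \<subseteq> {1..n}" using w by (auto simp: image_subset_iff)
  ultimately show ?thesis
    unfolding coded_def v_def by (intro conjI exI[of _ "\<lambda>k. - x (f k)"])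
qed

section \<open>Derivation in all directions\<close>

lemma coded_nonzero: "coded n v w \<Longrightarrow> v \<noteq> 0"
proof
  assume "coded n v w" "v = 0"
  then obtain x :: "int \<Rightarrow> real" where "\<forall>k. \<bar>x k\<bar> < 0"
    by (auto simp: coded_def halfwidth_def ray_def)
  then show False by simp
qed

text \<open>A coded word is brought into the standard sector, derived there, and brought back. The
  derivation commutes with an injective relabelling, because a letter stays sandwiched.\<close>

lemma coded_derivation:
  assumes "n > 1" "coded n v w"
  shows "admissible n w \<and> (\<exists>w'. derived w w' \<and> (\<exists>v'. coded n v' w'))"
proof -
  have n: "n > 0" "n \<noteq> 1" using assms(1) by auto
  obtain i u \<phi> \<rho> where i: "i < 2 * n" "u = v \<or> u = - v" "nu n i u = rcis \<rho> \<phi>"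
    and sector: "\<rho> > 0" "0 \<le> \<phi>" "\<phi> \<le> pi / (2 * real n)"
    by (rule sector_representative[OF n(1) coded_nonzero[OF assms(2)]])
  have w: "range w \<subseteq> {1..n}" using assms(2) unfolding coded_def by blast
  define w0 where "w0 = label_perm n i \<circ> w"
  have "coded n u w" using assms(2) i(2) coded_uminus by blast
  then have w0: "coded n (rcis \<rho> \<phi>) w0"
    using coded_label_perm[OF n i(1) w, of u] i(3) by (simp add: w0_def)
  have adm0: "admissible0 n w0" by (rule sector_admissible0[OF assms(1) w0 sector])
  then have adm: "admissible n w"
    unfolding admissible_def admissible_in_def w0_def using i(1) w by blast
  have "sandwiched w0 k \<longleftrightarrow> sandwiched w k" for k
    using inj_onD[OF label_perm_inj[OF n i(1)], of "w (k - 1)" "w (k + 1)"] w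
    unfolding sandwiched_def w0_def comp_def by (metis range_subsetD)
  then have same: "{k. sandwiched w0 k} = {k. sandwiched w k}" by simp
  obtain f :: "int \<Rightarrow> int" where f: "strict_mono f" "range f = {k. sandwiched w0 k}"
    by (rule sandwiched_enumeration[OF adm0])
  \<comment> \<open>The derived word is read in the original labels again, so the new direction is pulled back.\<close>
  obtain v' where v': "nu n i v' = veech n (rcis \<rho> \<phi>)"
  proof -
    have "nu n i (cis (real i * pi / (2 * real n)) * z) = z" if "even i" for z
      using that by (simp add: nu_def cis_mult flip: mult.assoc)
    moreover have "nu n i (nu n i z) = z" if "odd i" for z
      using that by (simp add: nu_def cis_mult cis_cnj flip: mult.assoc)
    ultimately show thesis using that by metis
  qed
  have "coded n (veech n (rcis \<rho> \<phi>)) (label_perm n i \<circ> (w \<circ> f))"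
    using sector_derived_coded[OF assms(1) w0 sector f(1,2)] by (simp add: w0_def comp_assoc)
  moreover have "range (w \<circ> f) \<subseteq> {1..n}" using w by auto
  ultimately have "coded n v' (w \<circ> f)" using coded_label_perm[OF n i(1), of "w \<circ> f" v'] v' by simp
  moreover have "derived w (w \<circ> f)" unfolding derived_def using f same by auto
  ultimately show ?thesis using adm by blast
qed

lemma coded_infinitely_derivable:
  assumes "n > 1" "coded n v w"
  shows "infinitely_derivable n w"
proof -
  have derivable: "derivable n w'" if "coded n v' w'" for v' w'
    using coded_derivation[OF assms(1) that] coded_derivation[OF assms(1)] unfolding derivable_def by blast
  have "\<exists>w'. (derived ^^ m) w w' \<and> (\<exists>v'. coded n v' w')" for m
  proof (induction m)
    case 0
    then show ?case using assms(2) by auto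
  next
    case (Suc m)
    then show ?case using coded_derivation[OF assms(1)] by (metis relpowp_Suc_I)
  qed
  then show ?thesis unfolding infinitely_derivable_def using derivable assms(2) by blast
qed

section \<open>From trajectories to codes\<close>

text \<open>In absolute value the angle lies between \<open>pi / (2 * n)\<close> and \<open>2 * pi - pi / (2 * n)\<close>, where the
  cosine is largest at the ends. The odd multiples are the angles between a normal and a vertex.\<close>

lemma cos_odd_multiple_le:
  fixes p :: int
  assumes "n > 0" "odd p" "\<bar>p\<bar> < 4 * int n"
  shows "cos (of_int p * (pi / (2 * real n))) \<le> cos (pi / (2 * real n))"
proof -
  define \<beta> where "\<beta> = pi / (2 * real n)"
  have \<beta>: "\<beta> > 0" "4 * real n * \<beta> = 2 * pi" using assms(1) by (auto simp: \<beta>_def)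
  define q where "q = real_of_int \<bar>p\<bar>"
  have "p \<noteq> 0" using assms(2) by auto
  then have "1 \<le> \<bar>p\<bar>" "\<bar>p\<bar> \<le> 4 * int n - 1" using assms(3) by linarith+
  then have q: "1 \<le> q" "q \<le> 4 * real n - 1" unfolding q_def by linarith+
  have "1 * \<beta> \<le> q * \<beta>" "q * \<beta> \<le> (4 * real n - 1) * \<beta>" using q \<beta>(1) by (intro mult_right_mono; simp)+
  then have q\<beta>: "\<beta> \<le> q * \<beta>" "q * \<beta> \<le> 2 * pi - \<beta>" using \<beta>(2) by (simp_all add: left_diff_distrib)
  have "\<beta> \<le> pi" using q\<beta> by linarith
  have "cos (q * \<beta>) \<le> cos \<beta>"
  proof (cases "q * \<beta> \<le> pi")
    case True
    then show ?thesis using q\<beta> \<beta>(1) by (intro cos_monotone_0_pi_le) auto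
  next
    case False
    then have "cos (2 * pi - q * \<beta>) \<le> cos \<beta>" using q\<beta> \<beta>(1) by (intro cos_monotone_0_pi_le) auto
    then show ?thesis by (simp add: cos_diff)
  qed
  moreover have "cos (of_int p * \<beta>) = cos (q * \<beta>)" by (cases "p \<ge> 0") (auto simp: q_def)
  ultimately show ?thesis by (simp add: \<beta>_def)
qed

lemma cis_inner_rcis: "cis a \<bullet> rcis r b = r * cos (a - b)"
  by (simp add: inner_complex_def cos_diff algebra_simps)

lemma polygon_halfplane:
  assumes "n > 0" "r > 0" "j < 2 * n" "z \<in> polygon n r"
  shows "cis (pi / 2 - real j * pi / real n) \<bullet> z \<le> r * cos (pi / (2 * real n))"
proof -
  let ?c = "cis (pi / 2 - real j * pi / real n)"
  have "polygon n r \<subseteq> {z. ?c \<bullet> z \<le> r * cos (pi / (2 * real n))}"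
    unfolding polygon_def
  proof (rule hull_minimal)
    show "vertex n r ` {..<2 * n} \<subseteq> {z. ?c \<bullet> z \<le> r * cos (pi / (2 * real n))}"
    proof clarsimp
      fix i assume i: "i < 2 * n"
      define p where "p = 2 * (int i - int j) - 1"
      have "odd p" "\<bar>p\<bar> < 4 * int n" using i assms(3) unfolding p_def by auto
      have "?c \<bullet> vertex n r i = r * cos ((pi / 2 - real j * pi / real n)
          - (pi / 2 + pi / (2 * real n) - real i * pi / real n))"
        unfolding vertex_def by (rule cis_inner_rcis)
      also have "(pi / 2 - real j * pi / real n) - (pi / 2 + pi / (2 * real n) - real i * pi / real n)
          = of_int p * (pi / (2 * real n))"
        using assms(1) by (simp add: p_def field_simps)
      finally show "?c \<bullet> vertex n r i \<le> r * cos (pi / (2 * real n))"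
        using cos_odd_multiple_le[OF assms(1) \<open>odd p\<close> \<open>\<bar>p\<bar> < 4 * int n\<close>] assms(2) by simp
    qed
    show "convex {z. ?c \<bullet> z \<le> r * cos (pi / (2 * real n))}" by (rule convex_halfspace_le)
  qed
  then show ?thesis using assms(4) by blast
qed

text \<open>The coordinates along and across the side, with the middle of the side at \<open>c = 0\<close> and the
  vertices at \<open>c = \<plusminus>1\<close>.\<close>

lemma side_point:
  assumes "n > 0" "p \<in> side n r j" "p \<notin> vertex n r ` {..<2 * n}" "j < 2 * n"
  obtains c where "\<bar>c\<bar> < 1"
    "p = complex_of_real (r * cos (pi / (2 * real n))) * cis (pi / 2 - real j * pi / real n)
       + complex_of_real (c * (r * sin (pi / (2 * real n)))) * cis (- (real j * pi / real n))"
proof -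
  obtain u where u: "0 \<le> u" "u \<le> 1" "p = (1 - u) *\<^sub>R vertex n r j + u *\<^sub>R vertex n r (j + 1)"
    using assms(2) unfolding side_def in_segment by blast
  have "vertex n r (2 * n) = vertex n r 0"
    using vertex_add_n[OF assms(1), of r n] vertex_add_n[OF assms(1), of r 0] by (simp add: mult_2)
  moreover have "j + 1 < 2 * n \<or> j + 1 = 2 * n" using assms(4) by linarith
  ultimately have "vertex n r (j + 1) \<in> vertex n r ` {..<2 * n}"
    using assms(1) by (metis imageI lessThan_iff mult_pos_pos pos2)
  moreover have "vertex n r j \<in> vertex n r ` {..<2 * n}" using assms(4) by blast
  ultimately have ends: "p \<noteq> vertex n r j" "p \<noteq> vertex n r (j + 1)" using assms(3) by metis+
  have "u \<noteq> 0" "u \<noteq> 1" using u(3) ends by auto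
  then have "\<bar>2 * u - 1\<bar> < 1" using u(1,2) by (auto simp: abs_less_iff)
  have "2 *\<^sub>R p = (vertex n r j + vertex n r (j + 1)) + (2 * u - 1) *\<^sub>R (vertex n r (j + 1) - vertex n r j)"
    unfolding u(3) by (simp add: algebra_simps scaleR_2)
  also have "\<dots> = 2 *\<^sub>R (complex_of_real (r * cos (pi / (2 * real n))) * cis (pi / 2 - real j * pi / real n)
       + complex_of_real ((2 * u - 1) * (r * sin (pi / (2 * real n)))) * cis (- (real j * pi / real n)))"
    unfolding vertex_sum[OF assms(1)] vertex_diff[OF assms(1)]
    by (simp add: scaleR_conv_of_real algebra_simps)
  finally show thesis using that[OF \<open>\<bar>2 * u - 1\<bar> < 1\<close>] by simp
qed

text \<open>Used for the height of a trajectory between two consecutive hits.\<close>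

lemma locally_constant_on_gap:
  fixes g :: "real \<Rightarrow> real"
  assumes "a < b"
    and left: "\<And>t. a < t \<Longrightarrow> t \<le> b \<Longrightarrow> \<forall>\<^sub>F s in at_left t. g s = g t"
    and right: "\<And>t. a < t \<Longrightarrow> t < b \<Longrightarrow> \<forall>\<^sub>F s in at_right t. g s = g t"
    and start: "\<forall>\<^sub>F s in at_right a. g s = c"
  shows "g b = c"
proof -
  have "(g has_real_derivative 0) (at t)" if "a < t" "t < b" for t
  proof -
    have "\<forall>\<^sub>F s in at t. g s = g t"
      using left[of t] right[of t] that by (simp add: eventually_at_split)
    then show ?thesis
      by (subst DERIV_cong_ev[OF refl _ refl, of _ "\<lambda>_. g t"]) (simp_all add: eventually_nhds_conv_at)
  qed
  then have const: "g s = g s'" if "s \<in> {a<..<b}" "s' \<in> {a<..<b}" for s s'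
    using DERIV_isconst3[OF assms(1) that] by simp
  have "\<forall>\<^sub>F s in at_right a. g s = c \<and> s \<in> {a<..<b}"
    using start eventually_at_right_real[OF assms(1)] by eventually_elim auto
  then obtain s where s: "g s = c" "s \<in> {a<..<b}"
    using eventually_happens'[OF trivial_limit_at_right_real] by blast
  have "\<forall>\<^sub>F s in at_left b. g s = g b \<and> s \<in> {a<..<b}"
    using left[of b] eventually_at_left_real[OF assms(1)] assms(1) by (intro eventually_conj) auto
  then obtain s' where s': "g s' = g b" "s' \<in> {a<..<b}"
    using eventually_happens'[OF trivial_limit_at_left_real] by blast
  show ?thesis using const[OF s(2) s'(2)] s(1) s'(1) by simp
qed

text \<open>Just before the hit the trajectory is in the polygon, hence on the inner side of the line
  through the side, so it does not move inwards. If it moved parallel to the side, it would have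
  been inside the side already before the hit, against the isolation of the hitting times.\<close>

lemma side_exit:
  assumes "n > 0" "n \<noteq> 1" "r > 0" "linear_trajectory n r v \<gamma>" "j < 2 * n" "\<gamma> t \<in> side n r j"
    and isolated: "a < t" "\<And>s i. a < s \<Longrightarrow> s < t \<Longrightarrow> i < 2 * n \<Longrightarrow> \<gamma> s \<notin> side n r i"
  shows "Im (v * cis (real j * pi / real n)) > 0"
proof (rule ccontr)
  define N where "N = cis (pi / 2 - real j * pi / real n)"
  define E where "E = cis (- (real j * pi / real n))"
  define R where "R = r * cos (pi / (2 * real n))"
  define L where "L = r * sin (pi / (2 * real n))"
  assume "\<not> Im (v * cis (real j * pi / real n)) > 0"
  have "cos (pi / (2 * real n)) > 0" "sin (pi / (2 * real n)) > 0"
    using assms(1,2) by (auto intro!: cos_gt_zero sin_gt_zero simp: field_simps)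
  then have "L > 0" using assms(3) by (simp add: L_def)
  have N: "N = \<i> * E" by (simp add: N_def E_def complex_eq_iff cos_diff sin_diff)
  have NE: "N \<bullet> N = 1" "N \<bullet> E = 0" "E \<bullet> E = 1"
    by (simp_all add: N E_def inner_complex_def flip: power2_eq_square)
  have Nv: "N \<bullet> v = Im (v * cis (real j * pi / real n))"
    by (simp add: N E_def inner_complex_def algebra_simps)
  have traj: "\<gamma> t \<notin> vertex n r ` {..<2 * n}" "\<gamma> s \<in> polygon n r"
    "\<forall>\<^sub>F s in at_left t. \<gamma> s = \<gamma> t + (s - t) *\<^sub>R v" "v \<noteq> 0" for s
    using assms(4) unfolding linear_trajectory_def by auto
  obtain c where c: "\<bar>c\<bar> < 1" "\<gamma> t = complex_of_real R * N + complex_of_real (c * L) * E"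
    using side_point[OF assms(1,6) traj(1) assms(5)] unfolding N_def E_def R_def L_def by metis
  have Nt: "N \<bullet> \<gamma> t = R" unfolding c(2) using NE
    by (simp add: inner_add_right flip: scaleR_conv_of_real)
  have near: "\<forall>\<^sub>F s in at_left t. \<gamma> s = \<gamma> t + (s - t) *\<^sub>R v \<and> s \<in> {a<..<t}"
    using traj(3) eventually_at_left_real[OF isolated(1)] by (intro eventually_conj) auto
  then obtain s where s: "\<gamma> s = \<gamma> t + (s - t) *\<^sub>R v" "a < s" "s < t"
    using eventually_happens'[OF trivial_limit_at_left_real] by fastforce
  have "N \<bullet> \<gamma> s \<le> R"
    unfolding N_def R_def using polygon_halfplane[OF assms(1,3,5) traj(2)] .
  then have "(s - t) * (N \<bullet> v) \<le> 0" using Nt by (simp add: s(1) inner_add_right)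
  then have "N \<bullet> v \<ge> 0" using s(3) by (simp add: mult_le_0_iff)
  then have "N \<bullet> v = 0" using \<open>\<not> Im (v * cis (real j * pi / real n)) > 0\<close> Nv by simp
  define d where "d = E \<bullet> v"
  have "v = complex_of_real (N \<bullet> v) * N + complex_of_real d * E"
  proof -
    have "(Re E)\<^sup>2 + (Im E)\<^sup>2 = 1" using NE(3) by (simp add: inner_complex_def power2_eq_square)
    then have "Re E * Re E = 1 - Im E * Im E" by (simp add: power2_eq_square)
    then show ?thesis
      by (simp add: complex_eq_iff N d_def inner_complex_def) algebra
  qed
  then have v: "v = complex_of_real d * E" using \<open>N \<bullet> v = 0\<close> by simp
  have "((\<lambda>s. \<bar>c * L + (s - t) * d\<bar>) \<longlongrightarrow> \<bar>c * L + (t - t) * d\<bar>) (at_left t)"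
    by (intro tendsto_intros)
  moreover have "\<bar>c * L + (t - t) * d\<bar> < L" using c(1) \<open>L > 0\<close> by (simp add: abs_mult)
  ultimately have "\<forall>\<^sub>F s in at_left t. \<bar>c * L + (s - t) * d\<bar> < L" by (rule order_tendstoD)
  with near have "\<forall>\<^sub>F s in at_left t. (\<gamma> s = \<gamma> t + (s - t) *\<^sub>R v \<and> s \<in> {a<..<t}) \<and> \<bar>c * L + (s - t) * d\<bar> < L"
    by (rule eventually_conj)
  then obtain s where s: "\<gamma> s = \<gamma> t + (s - t) *\<^sub>R v" "a < s" "s < t" "\<bar>c * L + (s - t) * d\<bar> < L"
    using eventually_happens'[OF trivial_limit_at_left_real] by fastforce
  define e where "e = (c * L + (s - t) * d) / L"
  have e: "\<bar>e\<bar> < 1" "e * L = c * L + (s - t) * d" using s(4) \<open>L > 0\<close> by (simp_all add: e_def)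
  have "2 *\<^sub>R \<gamma> s = complex_of_real (2 * R) * N + complex_of_real (2 * (e * L)) * E"
    unfolding s(1) c(2) v e(2) by (simp add: scaleR_conv_of_real algebra_simps)
  also have "\<dots> = (vertex n r j + vertex n r (j + 1)) + e *\<^sub>R (vertex n r (j + 1) - vertex n r j)"
    unfolding vertex_sum[OF assms(1)] vertex_diff[OF assms(1)] N_def E_def R_def L_def
    by (simp add: scaleR_conv_of_real algebra_simps)
  finally have "\<gamma> s = (1 - (1 + e) / 2) *\<^sub>R vertex n r j + ((1 + e) / 2) *\<^sub>R vertex n r (j + 1)"
    by (simp add: complex_eq_iff field_simps)
  then have "\<gamma> s \<in> side n r j"
    unfolding side_def in_segment using e(1) by (intro exI[of _ "(1 + e) / 2"]) auto
  then show False using isolated(2) s(2,3) assms(5) by blast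
qed

text \<open>The height \<open>h\<close> above the line \<open>\<real> v\<close> is constant between two hits and jumps at a hit by the
  height of the gluing translation. The code direction \<open>v'\<close> is \<open>v\<close> scaled by the apothem, so
  that the heights agree with those of the code.\<close>

lemma cutting_sequence_coded:
  assumes "n > 0" "n \<noteq> 1" "r > 0" "linear_trajectory n r v \<gamma>" "cutting_sequence n r \<gamma> w"
  shows "\<exists>v'. coded n v' w"
proof -
  define C where "C = r * cos (pi / (2 * real n))"
  define v' where "v' = complex_of_real C * v"
  have "cos (pi / (2 * real n)) > 0"
    using assms(1,2) by (intro cos_gt_zero) (auto simp: field_simps)
  then have C: "C > 0" "C * tan (pi / (2 * real n)) = r * sin (pi / (2 * real n))"
    using assms(3) by (simp_all add: C_def tan_def)
  obtain t :: "int \<Rightarrow> real" where t: "strict_mono t"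
      "range t = {s. \<exists>j<2 * n. \<gamma> s \<in> side n r j}"
      "\<forall>k. \<exists>j<2 * n. \<gamma> (t k) \<in> side n r j \<and> w k = label n j"
    using assms(5) unfolding cutting_sequence_def by blast
  obtain J where J: "J k < 2 * n" "\<gamma> (t k) \<in> side n r (J k)" "w k = label n (J k)" for k
    using choice[OF t(3)] by blast
  have free: "\<gamma> s \<notin> side n r i" if "t k < s" "s < t (k + 1)" "i < 2 * n" for s i k
  proof
    assume "\<gamma> s \<in> side n r i"
    then have "s \<in> range t" using that(3) unfolding t(2) by blast
    then obtain l where "s = t l" by blast
    then have "k < l" "l < k + 1" using that(1,2) t(1) by (simp_all add: strict_mono_less)
    then show False by simp
  qed
  define z where "z k = v' * cis (real (J k) * pi / real n)" for k
  have exits: "Im (z k) > 0" for k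
  proof -
    have "t (k - 1) < t k" using t(1) by (simp add: strict_monoD)
    then have "Im (v * cis (real (J k) * pi / real n)) > 0"
      using side_exit[OF assms(1-4) J(1,2), where a = "t (k - 1)"] free[of "k - 1"] by simp
    moreover have "z k = C *\<^sub>R (v * cis (real (J k) * pi / real n))"
      by (simp add: z_def v'_def scaleR_conv_of_real mult.assoc)
    ultimately show ?thesis using C(1) by simp
  qed
  define h where "h p = Im (cnj v * p)" for p
  have h_linear: "h (p + q) = h p + h q" "h (c *\<^sub>R p) = c * h p" "h v = 0" for p q c
    by (simp_all add: h_def algebra_simps)
  have h_mid: "h (complex_of_real C * cis (pi / 2 - real (J k) * pi / real n)) = Re (z k)" for k
    by (simp add: h_def z_def v'_def cos_diff sin_diff algebra_simps)
  define x where "x k = h (\<gamma> (t k)) - Re (z k)" for k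
  have traj: "\<gamma> s \<notin> vertex n r ` {..<2 * n}"
      "\<forall>\<^sub>F s' in at_left s. \<gamma> s' = \<gamma> s + (s' - s) *\<^sub>R v"
      "(\<And>j. j < 2 * n \<Longrightarrow> \<gamma> s \<notin> side n r j) \<Longrightarrow> \<forall>\<^sub>F s' in at_right s. \<gamma> s' = \<gamma> s + (s' - s) *\<^sub>R v"
      "\<And>j. j < 2 * n \<Longrightarrow> \<gamma> s \<in> side n r j \<Longrightarrow>
        \<forall>\<^sub>F s' in at_right s. \<gamma> s' = \<gamma> s + glue n r j + (s' - s) *\<^sub>R v" for s
    using assms(4) unfolding linear_trajectory_def by blast+
  have x_bound: "\<bar>x k\<bar> < tan (pi / (2 * real n)) * \<bar>Im (z k)\<bar>" for k
  proof -
    obtain c where c: "\<bar>c\<bar> < 1"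
      "\<gamma> (t k) = complex_of_real C * cis (pi / 2 - real (J k) * pi / real n)
       + complex_of_real (c * (C * tan (pi / (2 * real n)))) * cis (- (real (J k) * pi / real n))"
      by (rule side_point[OF assms(1) J(2) traj(1) J(1), of k, folded C_def C(2)])
    have "x k = - c * (tan (pi / (2 * real n)) * Im (z k))"
      unfolding x_def c(2) h_linear(1) h_mid
      by (simp add: h_def z_def v'_def algebra_simps)
    moreover have pos: "0 < tan (pi / (2 * real n)) * Im (z k)"
      using assms(1,2) exits by (intro mult_pos_pos tan_gt_zero) (auto simp: field_simps)
    ultimately have "\<bar>x k\<bar> = \<bar>c\<bar> * (tan (pi / (2 * real n)) * Im (z k))"
      by (simp only: abs_mult[of "- c"] abs_minus_cancel abs_of_pos)
    then show ?thesis using mult_strict_right_mono[OF c(1) pos] exits[of k] by simp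
  qed
  have x_step: "x k - x (k + 1) = Re (z k) + Re (z (k + 1))" for k
  proof -
    have "vertex n r (J k + n + 1) = - vertex n r (J k + 1)"
      using vertex_add_n[OF assms(1), of r "J k + 1"] by (simp add: ac_simps)
    then have "glue n r (J k) = - (vertex n r (J k) + vertex n r (J k + 1))"
      by (simp add: glue_def)
    also have "\<dots> = (- 2) *\<^sub>R (complex_of_real C * cis (pi / 2 - real (J k) * pi / real n))"
      unfolding vertex_sum[OF assms(1)] by (simp add: C_def scaleR_conv_of_real)
    finally have glue: "h (glue n r (J k)) = - 2 * Re (z k)" by (simp only: h_linear h_mid)
    have "h (\<gamma> (t (k + 1))) = h (\<gamma> (t k)) + h (glue n r (J k))"
    proof (rule locally_constant_on_gap[where g = "\<lambda>s. h (\<gamma> s)" and a = "t k"])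
      show "t k < t (k + 1)" using t(1) by (simp add: strict_monoD)
      show "\<forall>\<^sub>F s' in at_left s. h (\<gamma> s') = h (\<gamma> s)" for s
        using traj(2)[of s] by eventually_elim (simp add: h_linear)
      show "\<forall>\<^sub>F s' in at_right s. h (\<gamma> s') = h (\<gamma> s)" if "t k < s" "s < t (k + 1)" for s
      proof -
        have "\<forall>\<^sub>F s' in at_right s. \<gamma> s' = \<gamma> s + (s' - s) *\<^sub>R v"
          by (rule traj(3)) (rule free[OF that])
        then show ?thesis by eventually_elim (simp add: h_linear)
      qed
      show "\<forall>\<^sub>F s' in at_right (t k). h (\<gamma> s') = h (\<gamma> (t k)) + h (glue n r (J k))"
        using traj(4)[OF J(1,2)] by eventually_elim (simp add: h_linear)
    qed
    then show ?thesis unfolding x_def glue by simp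
  qed
  have "midheight n v' (w k) = Re (z k)" "halfwidth n v' (w k) = tan (pi / (2 * real n)) * \<bar>Im (z k)\<bar>" for k
    using midheight_label[OF assms(1) z_def] halfwidth_label[OF assms(1) z_def] exits[of k] J(3)[of k]
    by simp_all
  then have "\<forall>k. \<bar>x k\<bar> < halfwidth n v' (w k) \<and>
      x k - x (k + 1) = midheight n v' (w k) + midheight n v' (w (k + 1))"
    using x_bound x_step by simp
  moreover have "range w \<subseteq> {1..n}" using label_in[OF assms(1)] J(3) by (simp add: image_subset_iff)
  ultimately have "coded n v' w" unfolding coded_def by blast
  then show ?thesis by blast
qed

theorem theorem6p2p1:
  fixes n :: nat and r :: real and v :: complex
    and \<gamma> :: "real \<Rightarrow> complex" and w :: "int \<Rightarrow> nat"
  assumes "n \<ge> 3" and "r > 0"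
    and "linear_trajectory n r v \<gamma>"
    and "cutting_sequence n r \<gamma> w"
  shows "infinitely_derivable n w"
proof -
  have "n > 0" "n \<noteq> 1" "n > 1" using assms(1) by simp_all
  then show ?thesis
    using cutting_sequence_coded[OF _ _ assms(2-4)] coded_infinitely_derivable by blast
qed

end
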